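(* For every constant $c>0$ there exists an increasing sequence of real numbers $(x_n)_{n\ge1}$ with $x_{n+1}-x_n\ge 1$ for all $n$, such that, with $\gamma_N=\frac{\log N\,(\log\log N)^{1+c}}{N}$, the additive energy satisfies $E_{N,\gamma_N}\gg N^3$ (i.e. $E_{N,\gamma_N}\ge C N^3$ for some constant $C>0$ and all sufficiently large $N$), and such that for Lebesgue-almost every $\alpha\in\mathbb{R}$ the sequence $(\alpha x_n)_{n\ge1}$ has Poissonian pair correlation.
   Context: For a real sequence $(x_n)$, $N\ge1$ and $\gamma>0$, the additive energy at scale $\gamma$ is $E_{N,\gamma}=\#\{1\le a,b,c,d\le N : |x_a+x_b-x_c-x_d|<\gamma\}$. $\|x\|$ denotes the distance from $x$ to the nearest integer. A real sequence $(y_n)_{n\ge1}$ has Poissonian pair correlation if for every $s>0$, $\lim_{N\to\infty}\frac1N\#\{(m,n): 1\le m\ne n\le N,\ \|y_m-y_n\|<s/N\}=2s$. *)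

theory Defs
  imports "HOL-Analysis.Analysis"
begin

definition dist_int :: "real \<Rightarrow> real" where
  "dist_int x = (INF k::int. \<bar>x - of_int k\<bar>)"

definition add_energy :: "(nat \<Rightarrow> real) \<Rightarrow> nat \<Rightarrow> real \<Rightarrow> nat" where
  "add_energy x N \<gamma> = card {(a, b, c, d). a \<in> {1..N} \<and> b \<in> {1..N} \<and> c \<in> {1..N} \<and> d \<in> {1..N}
      \<and> \<bar>x a + x b - x c - x d\<bar> < \<gamma>}"

definition poissonian_pc :: "(nat \<Rightarrow> real) \<Rightarrow> bool" where
  "poissonian_pc y \<longleftrightarrow> (\<forall>s>0.
     (\<lambda>N. real (card {(m, n). m \<in> {1..N} \<and> n \<in> {1..N} \<and> m \<noteq> n
                    \<and> dist_int (y m - y n) < s / real N}) / real N)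
     \<longlonglongrightarrow> 2 * s)"

end

theory Submission
  imports Defs "HOL-Probability.Probability" "HOL-Library.Discrete_Functions"
    "HOL-Number_Theory.Cong" "HOL-Analysis.Kronecker_Approximation_Theorem" "HOL-Real_Asymp.Real_Asymp"
begin

text \<open>Take \<open>x n = 2 * n + \<delta> j * u n\<close> for \<open>2 ^ j \<le> n < 2 ^ (j + 1)\<close>, where \<open>\<delta> j\<close> is a small multiple of
  \<open>\<gamma> N\<close> at \<open>N = 2 ^ j\<close> and the \<open>u n\<close> are independent and uniform on \<open>[0, 1]\<close>. Quadruples
  \<open>a + b = c + d\<close> inside one dyadic block satisfy \<open>\<bar>x a + x b - x c - x d\<bar> \<le> 2 * \<delta> j\<close>, which gives the
  energy bound.

  Fix \<open>\<alpha>\<close>. Averaging over \<open>u n\<close> replaces the window of length \<open>2 * s / N\<close> in the pair correlation by a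
  window of length about \<open>\<alpha> * \<delta> j\<close>, and the expected number of partners of a given point is asymptotically
  correct as soon as \<open>2 * \<alpha> * n mod 1\<close> is equidistributed over dyadic blocks at that scale. By Dirichlet's
  theorem and counting over full periods this only requires a denominator \<open>q\<close> of a rational approximation
  to \<open>2 * \<alpha>\<close> with \<open>1 / \<delta> j \<lless> q \<lless> 2 ^ j\<close>. The Borel--Cantelli lemma supplies it for almost every
  \<open>\<alpha>\<close>, because \<open>1 / (2 ^ j * \<delta> j)\<close>, which is of order \<open>1 / (j * (ln j) powr (1 + c))\<close>, is summable.

  The fluctuation of the pair count over \<open>u\<close> has second moment \<open>O(N)\<close>, so the pair correlation converges
  almost surely along \<open>N = k\<^sup>2\<close>, and monotonicity fills the gaps between squares. Finally Fubini exchanges the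
  two almost-everywhere quantifiers.\<close>

section \<open>Equidistribution of arithmetic progressions at small scales\<close>

lemma dist_int_less_iff: "dist_int x < r \<longleftrightarrow> (\<exists>k::int. \<bar>x - of_int k\<bar> < r)"
proof -
  have "bdd_below (range (\<lambda>k::int. \<bar>x - of_int k\<bar>))"
    by (rule bdd_belowI[of _ 0]) auto
  then show ?thesis
    unfolding dist_int_def by (subst cINF_less_iff) auto
qed

lemma dist_int_minus_less_iff: "dist_int (- x) < r \<longleftrightarrow> dist_int x < r"
proof -
  have "dist_int y < r \<Longrightarrow> dist_int (- y) < r" for y
  proof -
    assume "dist_int y < r"
    then obtain k :: int where "\<bar>y - of_int k\<bar> < r"
      by (auto simp: dist_int_less_iff)
    then have "\<bar>- y - of_int (- k)\<bar> < r" by simp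
    then show ?thesis unfolding dist_int_less_iff by blast
  qed
  from this[of x] this[of "- x"] show ?thesis by auto
qed

lemma borel_measurable_dist_int [measurable]: "dist_int \<in> borel_measurable borel"
  by (subst borel_measurable_iff_less) (auto simp: dist_int_less_iff intro!: measurable)

section \<open>Counting integers in intervals and hits of an arithmetic progression\<close>

lemma int_interval_eq: "{t::int. a \<le> real_of_int t \<and> real_of_int t \<le> b} = {\<lceil>a\<rceil>..\<lfloor>b\<rfloor>}"
  by (auto simp: ceiling_le_iff le_floor_iff)

text \<open>The hypothesis makes the right-hand side nonnegative, which covers intervals without
  integers.\<close>

lemma card_int_interval_le:
  assumes "a \<le> b + 1"
  shows "real (card {t::int. a \<le> real_of_int t \<and> real_of_int t \<le> b}) \<le> b - a + 1"
proof -
  have "real_of_int \<lfloor>b\<rfloor> \<le> b" "a \<le> real_of_int \<lceil>a\<rceil>" by auto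
  with assms show ?thesis
    unfolding int_interval_eq
    by (cases "\<lfloor>b\<rfloor> + 1 - \<lceil>a\<rceil> \<ge> 0") (simp_all add: of_nat_nat, linarith+)
qed

lemma card_int_interval_ge:
  "b - a - 1 \<le> real (card {t::int. a \<le> real_of_int t \<and> real_of_int t \<le> b})"
proof -
  have "b - 1 < real_of_int \<lfloor>b\<rfloor>" "real_of_int \<lceil>a\<rceil> < a + 1" by linarith+
  then show ?thesis
    unfolding int_interval_eq
    by (cases "\<lfloor>b\<rfloor> + 1 - \<lceil>a\<rceil> \<ge> 0") (simp_all add: of_nat_nat, linarith+)
qed

lemma finite_int_interval_shift: "finite {p::int. 0 \<le> w - real_of_int p \<and> w - real_of_int p \<le> lam}"
proof -
  have "{p::int. 0 \<le> w - real_of_int p \<and> w - real_of_int p \<le> lam}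
      = {t::int. w - lam \<le> real_of_int t \<and> real_of_int t \<le> w}" by auto
  then show ?thesis by (simp add: int_interval_eq)
qed

text \<open>The event that \<open>w\<close> modulo 1 lies in \<open>[0, lam]\<close>, counted with
  multiplicity so that windows longer than 1 are allowed; for \<open>lam \<ge> 0\<close> the mean
  over a period of \<open>w\<close> is \<open>lam\<close>.\<close>

definition int_hits :: "real \<Rightarrow> real \<Rightarrow> nat" where
  "int_hits lam w = card {p::int. 0 \<le> w - of_int p \<and> w - of_int p \<le> lam}"

text \<open>The point \<open>r * \<theta>\<close> is within \<open>1 / q\<close> of
  \<open>r * h / q\<close>, and these fractions run once through the multiples of
  \<open>1 / q\<close> modulo 1. The error 3 is one unit for each displaced endpoint and one for
  counting integers in an interval.\<close>

lemma int_hits_full_period: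
  fixes q :: nat and h :: int and \<theta> z lam :: real
  assumes q: "q > 0" and cop: "coprime h (int q)" and approx: "\<bar>real q * \<theta> - of_int h\<bar> \<le> 1 / real q"
    and lam: "lam \<ge> 0"
  shows "\<bar>(\<Sum>r<q. real (int_hits lam (z + real r * \<theta>))) - real q * lam\<bar> \<le> 3"
proof -
  let ?P = "\<lambda>r. {p::int. 0 \<le> z + real r * \<theta> - of_int p \<and> z + real r * \<theta> - of_int p \<le> lam}"
  define S where "S = (SIGMA r:{..<q}. ?P r)"
  \<comment> \<open>\<open>g\<close> maps \<open>{..<q} \<times> UNIV\<close> bijectively onto the integers, and up to the error \<open>r * e\<close> the hits
    correspond to the integers in an interval of length \<open>q * lam\<close>.\<close>
  define g where "g = (\<lambda>(r::nat, p::int). int r * h - p * int q)"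
  have finS: "finite S"
    unfolding S_def by (intro finite_SigmaI finite_int_interval_shift) auto
  have sum_eq: "(\<Sum>r<q. real (int_hits lam (z + real r * \<theta>))) = real (card S)"
    unfolding S_def int_hits_def by (subst card_SigmaI) ((use finite_int_interval_shift in blast)+, simp)
  define e where "e = real q * \<theta> - of_int h"
  have e: "\<bar>real r * e\<bar> \<le> 1" if "r < q" for r
  proof -
    have "\<bar>real r * e\<bar> \<le> real q * (1 / real q)"
      unfolding abs_mult using that approx by (intro mult_mono) (auto simp: e_def)
    then show ?thesis using q by simp
  qed
  have scaled: "real q * (z + real r * \<theta> - of_int p) = real q * z + of_int (g (r, p)) + real r * e" for r p
    by (simp add: g_def e_def algebra_simps)
  \<comment> \<open>Since \<open>h\<close> is invertible modulo \<open>q\<close>, the value of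
    \<open>g\<close> determines \<open>r\<close> modulo \<open>q\<close>, hence \<open>r\<close>,
    and then \<open>p\<close>.\<close>
  have inj: "inj_on g S"
  proof (rule inj_onI, clarsimp simp: S_def g_def)
    fix r r' :: nat and p p' :: int
    assume r: "r < q" "r' < q" and eq: "int r * h - p * int q = int r' * h - p' * int q"
    have "(int r - int r') * h = (p - p') * int q" using eq by (simp add: algebra_simps)
    then have "int q dvd (int r - int r') * h" by simp
    then have "int q dvd int r - int r'"
      using cop by (simp add: coprime_commute coprime_dvd_mult_left_iff)
    then have "int r = int r'"
      using r by (metis abs_of_nat dvd_imp_le_int int_ops(1) linorder_not_le mod_eq_dvd_iff
          mod_pos_pos_trivial of_nat_0_le_iff of_nat_less_iff)
    then show "r = r' \<and> p = p'" using eq q by auto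
  qed
  have upper: "g ` S \<subseteq> {t::int. - real q * z - 1 \<le> of_int t \<and> of_int t \<le> real q * (lam - z) + 1}"
  proof clarify
    fix r p assume "(r, p) \<in> S"
    then have r: "r < q" and "0 \<le> z + real r * \<theta> - of_int p" "z + real r * \<theta> - of_int p \<le> lam"
      by (auto simp: S_def)
    then have "0 \<le> real q * (z + real r * \<theta> - of_int p)"
      "real q * (z + real r * \<theta> - of_int p) \<le> real q * lam"
      by (auto intro: mult_left_mono)
    with e[OF r] show "- real q * z - 1 \<le> of_int (g (r, p)) \<and> of_int (g (r, p)) \<le> real q * (lam - z) + 1"
      unfolding scaled by (auto simp: algebra_simps abs_le_iff)
  qed
  have "card S = card (g ` S)" using inj by (simp add: card_image)
  also have "\<dots> \<le> card {t::int. - real q * z - 1 \<le> of_int t \<and> of_int t \<le> real q * (lam - z) + 1}"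
    using upper by (intro card_mono) (simp_all add: int_interval_eq)
  finally have "real (card S) \<le> real (card {t::int. - real q * z - 1 \<le> of_int t \<and> of_int t \<le> real q * (lam - z) + 1})"
    by simp
  also have "\<dots> \<le> real q * (lam - z) + 1 - (- real q * z - 1) + 1"
    using lam by (intro card_int_interval_le) (simp add: algebra_simps)
  finally have up: "real (card S) \<le> real q * lam + 3" by (simp add: algebra_simps)
  have lower: "{t::int. - real q * z + 1 \<le> of_int t \<and> of_int t \<le> real q * (lam - z) - 1} \<subseteq> g ` S"
  proof clarify
    fix t :: int
    assume t: "- real q * z + 1 \<le> of_int t" "of_int t \<le> real q * (lam - z) - 1"
    \<comment> \<open>The preimage of \<open>t\<close>: \<open>r\<close> is the residue of
      \<open>t / h\<close> modulo \<open>q\<close>, and \<open>p\<close> absorbs the multiple of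
      \<open>q\<close>. Shrinking the interval by 1 at each end keeps the point a hit despite the
      error \<open>r * e\<close>.\<close>
    obtain h' where "[h * h' = 1] (mod int q)"
      using cop cong_solve_coprime_int by blast
    then have "[h * (h' * t) = t] (mod int q)"
      by (metis cong_scalar_right mult.assoc mult_1)
    define r where "r = nat ((h' * t) mod int q)"
    have r: "r < q" "int r = (h' * t) mod int q"
      using q by (auto simp: r_def nat_less_iff)
    have "[int r * h = t] (mod int q)"
      using \<open>[h * (h' * t) = t] (mod int q)\<close> unfolding r
      by (simp add: cong_def mod_mult_right_eq mult.commute[of _ h])
    then obtain p where p: "int r * h - t = p * int q"
      by (metis cong_iff_dvd_diff dvd_def mult.commute)
    then have g: "g (r, p) = t" by (simp add: g_def)
    have "0 \<le> real q * (z + real r * \<theta> - of_int p)"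
      "real q * (z + real r * \<theta> - of_int p) \<le> real q * lam"
      unfolding scaled g using t e[OF r(1)] by (auto simp: algebra_simps abs_le_iff)
    then have "(r, p) \<in> S"
      using q r(1) by (auto simp: S_def zero_le_mult_iff)
    with g show "t \<in> g ` S" by force
  qed
  have "real q * (lam - z) - 1 - (- real q * z + 1) - 1
      \<le> real (card {t::int. - real q * z + 1 \<le> of_int t \<and> of_int t \<le> real q * (lam - z) - 1})"
    by (rule card_int_interval_ge)
  also have "\<dots> \<le> real (card (g ` S))"
    using lower finS by (simp add: card_mono)
  also have "\<dots> = real (card S)" using inj by (simp add: card_image)
  finally have "real q * lam - 3 \<le> real (card S)" by (simp add: algebra_simps)
  with up show ?thesis unfolding sum_eq by linarith
qed

text \<open>Full periods are split off one at a time, each costing 3, and the incomplete remainder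
  is compared with a full period. Splitting off shifts the start by \<open>q * \<theta>\<close>,
  hence the induction over arbitrary \<open>z\<close>.\<close>

lemma int_hits_discrepancy:
  fixes q :: nat and h :: int and \<theta> z lam :: real
  assumes q: "q > 0" and cop: "coprime h (int q)" and approx: "\<bar>real q * \<theta> - of_int h\<bar> \<le> 1 / real q"
    and lam: "lam \<ge> 0"
  shows "\<bar>(\<Sum>r<M. real (int_hits lam (z + real r * \<theta>))) - real M * lam\<bar>
    \<le> 3 * real M / real q + real q * lam + 3"
proof (induction M arbitrary: z rule: less_induct)
  case (less M)
  show ?case
  proof (cases "M < q")
    case True
    have "(\<Sum>r<M. real (int_hits lam (z + real r * \<theta>))) \<le> (\<Sum>r<q. real (int_hits lam (z + real r * \<theta>)))"
      using True by (intro sum_mono2) auto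
    also have "\<dots> \<le> real q * lam + 3"
      using int_hits_full_period[OF assms, of z] by linarith
    finally have 1: "(\<Sum>r<M. real (int_hits lam (z + real r * \<theta>))) \<le> real q * lam + 3" .
    have 2: "0 \<le> (\<Sum>r<M. real (int_hits lam (z + real r * \<theta>)))" by (intro sum_nonneg) auto
    have 3: "real M * lam \<le> real q * lam" "0 \<le> real M * lam" "0 \<le> 3 * real M / real q"
      using True lam by (auto intro: mult_right_mono)
    show ?thesis using 1 2 3 by linarith
  next
    case False
    then have qM: "q \<le> M" by simp
    let ?f = "\<lambda>r. real (int_hits lam (z + real r * \<theta>))"
    have "(\<Sum>r<M. ?f r) = (\<Sum>r<q. ?f r) + (\<Sum>r\<in>{q..<M}. ?f r)"
      using qM by (metis atLeast0LessThan sum.atLeastLessThan_concat zero_le)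
    also have "(\<Sum>r\<in>{q..<M}. ?f r) = (\<Sum>r<M - q. real (int_hits lam ((z + real q * \<theta>) + real r * \<theta>)))"
      by (rule sum.reindex_bij_witness[of _ "\<lambda>r. r + q" "\<lambda>r. r - q"])
        (auto simp: algebra_simps of_nat_diff)
    finally have eq: "(\<Sum>r<M. ?f r) = (\<Sum>r<q. ?f r)
      + (\<Sum>r<M - q. real (int_hits lam ((z + real q * \<theta>) + real r * \<theta>)))" .
    have "\<bar>(\<Sum>r<M - q. real (int_hits lam ((z + real q * \<theta>) + real r * \<theta>))) - real (M - q) * lam\<bar>
      \<le> 3 * real (M - q) / real q + real q * lam + 3"
      using q qM by (intro less.IH) auto
    moreover have "3 * real (M - q) / real q = 3 * real M / real q - 3"
      using q qM by (simp add: of_nat_diff field_simps)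
    moreover have "real (M - q) * lam = real M * lam - real q * lam"
      using qM by (simp add: of_nat_diff algebra_simps)
    ultimately show ?thesis
      using int_hits_full_period[OF assms, of z] unfolding eq by linarith
  qed
qed

section \<open>Chance that a uniformly perturbed point hits a small window\<close>

definition hit_prob :: "real \<Rightarrow> real \<Rightarrow> real \<Rightarrow> real" where
  "hit_prob l \<sigma> w = measure lborel {y \<in> {0..1}. dist_int (w - l * y) < \<sigma>}"

lemma hit_set_interval:
  fixes l :: real assumes "l > 0"
  shows "{y. \<bar>w - l * y - p\<bar> < \<sigma>} = {(w - p - \<sigma>) / l <..< (w - p + \<sigma>) / l}"
  using assms by (auto simp: field_simps abs_less_iff)

text \<open>An integer \<open>p\<close> contributes a set of \<open>y\<close> of length
  \<open>2 * \<sigma> / l\<close>, and it is reachable from \<open>[0, 1]\<close> only if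
  \<open>int_hits\<close> counts it; the union bound finishes.\<close>

lemma hit_prob_le:
  assumes l: "l > 0" and \<sigma>: "\<sigma> > 0"
  shows "hit_prob l \<sigma> w \<le> 2 * \<sigma> / l * int_hits (l + 2 * \<sigma>) (w + \<sigma>)"
proof -
  let ?P = "{p::int. 0 \<le> w + \<sigma> - of_int p \<and> w + \<sigma> - of_int p \<le> l + 2 * \<sigma>}"
  let ?I = "\<lambda>p::int. {y. \<bar>w - l * y - of_int p\<bar> < \<sigma>}"
  have fin: "finite ?P" by (rule finite_int_interval_shift)
  have sub: "{y \<in> {0..1}. dist_int (w - l * y) < \<sigma>} \<subseteq> (\<Union>p\<in>?P. ?I p)"
  proof
    fix y :: real assume "y \<in> {y \<in> {0..1}. dist_int (w - l * y) < \<sigma>}"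
    then have y: "0 \<le> y" "y \<le> 1" "dist_int (w - l * y) < \<sigma>" by auto
    then obtain p :: int where p: "\<bar>w - l * y - of_int p\<bar> < \<sigma>" by (auto simp: dist_int_less_iff)
    have "0 \<le> l * y" "l * y \<le> l" using y l by (auto simp: mult_le_cancel_left1)
    with p have "p \<in> ?P" by (simp add: abs_less_iff)
    with p show "y \<in> (\<Union>p\<in>?P. ?I p)" by blast
  qed
  have I: "?I p \<in> fmeasurable lborel" "measure lborel (?I p) = 2 * \<sigma> / l" for p
    unfolding hit_set_interval[OF l] using l \<sigma>
    by (auto simp: fmeasurable_def divide_right_mono diff_divide_distrib add_divide_distrib)
  have "hit_prob l \<sigma> w \<le> measure lborel (\<Union>p\<in>?P. ?I p)"
    unfolding hit_prob_def
    by (intro measure_mono_fmeasurable sub fmeasurable.finite_UN fin I) measurable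
  also have "\<dots> \<le> (\<Sum>p\<in>?P. measure lborel (?I p))"
    using fin I by (intro measure_UNION_le) auto
  also have "\<dots> = 2 * \<sigma> / l * int_hits (l + 2 * \<sigma>) (w + \<sigma>)"
    by (simp add: I int_hits_def)
  finally show ?thesis .
qed

text \<open>Only those \<open>p\<close> are kept whose whole interval of \<open>y\<close> lies in
  \<open>[0, 1]\<close>. As \<open>\<sigma> \<le> 1 / 2\<close>, these intervals are disjoint and
  their lengths add up.\<close>

lemma hit_prob_ge:
  assumes l: "l > 0" and \<sigma>: "\<sigma> > 0" "\<sigma> \<le> 1 / 2"
  shows "2 * \<sigma> / l * int_hits (l - 2 * \<sigma>) (w - \<sigma>) \<le> hit_prob l \<sigma> w"
proof -
  let ?P = "{p::int. 0 \<le> w - \<sigma> - of_int p \<and> w - \<sigma> - of_int p \<le> l - 2 * \<sigma>}"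
  let ?I = "\<lambda>p::int. {y. \<bar>w - l * y - of_int p\<bar> < \<sigma>}"
  have fin: "finite ?P" by (rule finite_int_interval_shift)
  have sub: "(\<Union>p\<in>?P. ?I p) \<subseteq> {y \<in> {0..1}. dist_int (w - l * y) < \<sigma>}"
  proof
    fix y :: real assume "y \<in> (\<Union>p\<in>?P. ?I p)"
    then obtain p :: int where p: "0 \<le> w - \<sigma> - of_int p" "w - \<sigma> - of_int p \<le> l - 2 * \<sigma>"
      "\<bar>w - l * y - of_int p\<bar> < \<sigma>" by blast
    then have "0 \<le> l * y" "l * y \<le> l * 1" by linarith+
    then have "0 \<le> y" "y \<le> 1" using l by (auto simp: zero_le_mult_iff)
    with p(3) show "y \<in> {y \<in> {0..1}. dist_int (w - l * y) < \<sigma>}"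
      by (auto simp: dist_int_less_iff)
  qed
  have I: "?I p \<in> fmeasurable lborel" "measure lborel (?I p) = 2 * \<sigma> / l" for p
    unfolding hit_set_interval[OF l] using l \<sigma>
    by (auto simp: fmeasurable_def divide_right_mono diff_divide_distrib add_divide_distrib)
  have disj: "disjoint_family_on ?I ?P"
  proof (clarsimp simp: disjoint_family_on_def)
    fix p p' :: int assume "p \<noteq> p'"
    show "{y. \<bar>w - l * y - of_int p\<bar> < \<sigma>} \<inter> {y. \<bar>w - l * y - of_int p'\<bar> < \<sigma>} = {}"
    proof (rule ccontr)
      assume "{y. \<bar>w - l * y - of_int p\<bar> < \<sigma>} \<inter> {y. \<bar>w - l * y - of_int p'\<bar> < \<sigma>} \<noteq> {}"
      then obtain y where "\<bar>w - l * y - of_int p\<bar> < \<sigma>" "\<bar>w - l * y - of_int p'\<bar> < \<sigma>" by auto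
      then have "\<bar>real_of_int p - of_int p'\<bar> < 1" using \<sigma> by linarith
      then show False using \<open>p \<noteq> p'\<close> by linarith
    qed
  qed
  have "2 * \<sigma> / l * int_hits (l - 2 * \<sigma>) (w - \<sigma>) = (\<Sum>p\<in>?P. measure lborel (?I p))"
    by (simp add: I int_hits_def)
  also have "\<dots> = measure lborel (\<Union>p\<in>?P. ?I p)"
    using fin I disj fmeasurableD2[OF I(1)]
    by (intro measure_finite_Union[symmetric]) (blast intro: fmeasurableD | simp)+
  also have "\<dots> \<le> hit_prob l \<sigma> w"
    unfolding hit_prob_def
  proof (intro measure_mono_fmeasurable sub)
    show "(\<Union>p\<in>?P. ?I p) \<in> sets lborel" using fin I by (intro sets.finite_UN) auto
    have "{0..1::real} \<in> fmeasurable lborel" by (simp add: fmeasurable_def)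
    then show "{y \<in> {0..1}. dist_int (w - l * y) < \<sigma>} \<in> fmeasurable lborel"
      by (rule fmeasurableI2) (blast, measurable)
  qed
  finally show ?thesis .
qed

lemma hit_prob_nonneg: "0 \<le> hit_prob l \<sigma> w"
  by (simp add: hit_prob_def)

text \<open>The two bounds for \<open>hit_prob\<close> turn the sum into hit counts for windows of
  length \<open>l + 2 * \<sigma>\<close> and \<open>l - 2 * \<sigma>\<close>, to which the
  discrepancy bound applies. The main term is \<open>2 * \<sigma> / l\<close> times
  \<open>M * l\<close>.\<close>

lemma hit_prob_block:
  fixes q :: nat and h :: int and \<theta> z l \<sigma> :: real
  assumes q: "q > 0" and cop: "coprime h (int q)" and approx: "\<bar>real q * \<theta> - of_int h\<bar> \<le> 1 / real q"
    and l: "l > 0" and \<sigma>: "\<sigma> > 0" "\<sigma> \<le> 1 / 2"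
  shows "\<bar>(\<Sum>r<M. hit_prob l \<sigma> (z + real r * \<theta>)) - 2 * \<sigma> * real M\<bar>
    \<le> 2 * \<sigma> / l * (2 * \<sigma> * real M + 3 * real M / real q + real q * (l + 2 * \<sigma>) + 3)"
proof -
  let ?S = "\<Sum>r<M. hit_prob l \<sigma> (z + real r * \<theta>)"
  let ?c = "2 * \<sigma> / l"
  have c: "?c > 0" using l \<sigma> by simp
  have "?S \<le> (\<Sum>r<M. ?c * int_hits (l + 2 * \<sigma>) (z + real r * \<theta> + \<sigma>))"
    by (intro sum_mono hit_prob_le l \<sigma>)
  also have "\<dots> = ?c * (\<Sum>r<M. real (int_hits (l + 2 * \<sigma>) ((z + \<sigma>) + real r * \<theta>)))"
    by (simp add: sum_distrib_left algebra_simps)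
  also have "\<dots> \<le> ?c * (real M * (l + 2 * \<sigma>) + (3 * real M / real q + real q * (l + 2 * \<sigma>) + 3))"
    using int_hits_discrepancy[OF q cop approx, where lam = "l + 2 * \<sigma>" and M = M and z = "z + \<sigma>"] l \<sigma> c
    by (intro mult_left_mono) linarith+
  also have "\<dots> = 2 * \<sigma> * real M
      + ?c * (2 * \<sigma> * real M + 3 * real M / real q + real q * (l + 2 * \<sigma>) + 3)"
    using l by (simp add: field_simps)
  finally have up: "?S \<le> \<dots>" .
  have lo: "2 * \<sigma> * real M
      - ?c * (2 * \<sigma> * real M + 3 * real M / real q + real q * (l + 2 * \<sigma>) + 3) \<le> ?S"
  proof (cases "2 * \<sigma> \<le> l")
    case True
    have "2 * \<sigma> * real M
      - ?c * (2 * \<sigma> * real M + 3 * real M / real q + real q * (l + 2 * \<sigma>) + 3)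
      = ?c * (real M * (l - 2 * \<sigma>) - (3 * real M / real q + real q * (l + 2 * \<sigma>) + 3))"
      using l by (simp add: field_simps)
    also have "\<dots> \<le> ?c * (real M * (l - 2 * \<sigma>) - (3 * real M / real q + real q * (l - 2 * \<sigma>) + 3))"
      using c \<sigma> by (intro mult_left_mono diff_left_mono add_mono) auto
    also have "\<dots> \<le> ?c * (\<Sum>r<M. real (int_hits (l - 2 * \<sigma>) ((z - \<sigma>) + real r * \<theta>)))"
      using int_hits_discrepancy[OF q cop approx, where lam = "l - 2 * \<sigma>" and M = M and z = "z - \<sigma>"] True c
      by (intro mult_left_mono) linarith+
    also have "\<dots> = (\<Sum>r<M. ?c * int_hits (l - 2 * \<sigma>) (z + real r * \<theta> - \<sigma>))"
      by (simp add: sum_distrib_left algebra_simps)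
    also have "\<dots> \<le> ?S"
      by (intro sum_mono hit_prob_ge l \<sigma>)
    finally show ?thesis .
  next
    case False
    \<comment> \<open>The shortened window would have negative length here, but the error term is at
      least the main term, so nonnegativity of the sum suffices.\<close>
    have "2 * \<sigma> * real M = ?c * (l * real M)" using l by simp
    also have "\<dots> \<le> ?c * (2 * \<sigma> * real M + 3 * real M / real q + real q * (l + 2 * \<sigma>) + 3)"
    proof (intro mult_left_mono)
      have "l * real M \<le> 2 * \<sigma> * real M" using False by (intro mult_right_mono) auto
      moreover have "0 \<le> 3 * real M / real q" "0 \<le> real q * (l + 2 * \<sigma>)" using l \<sigma> by auto
      ultimately show "l * real M \<le> 2 * \<sigma> * real M + 3 * real M / real q + real q * (l + 2 * \<sigma>) + 3"
        by linarith
    qed (use c in auto)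
    finally show ?thesis
      using sum_nonneg[of "{..<M}" "\<lambda>r. hit_prob l \<sigma> (z + real r * \<theta>)"] hit_prob_nonneg by force
  qed
  show ?thesis using up lo by linarith
qed

section \<open>Diophantine approximation of almost every multiplier\<close>

text \<open>The set is covered by intervals of length \<open>2 * \<rho> / k\<close> around fractions
  \<open>p / k\<close>, and the number of relevant \<open>p\<close> is at most
  \<open>k * (2 * R + 3)\<close>. The factor \<open>k\<close> cancels, so the bound is uniform in
  \<open>k\<close>.\<close>

lemma measure_near_integer_multiple_le:
  fixes R \<rho> :: real and k :: nat
  assumes k: "k \<ge> 1" and \<rho>: "0 < \<rho>" "\<rho> \<le> 1" and R: "R \<ge> 0"
  shows "measure lborel {\<alpha> \<in> {-R..R}. dist_int (real k * \<alpha>) < \<rho>} \<le> (2 * R + 3) * (2 * \<rho>)"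
proof -
  let ?P = "{p::int. - (real k * R + 1) \<le> of_int p \<and> of_int p \<le> real k * R + 1}"
  let ?I = "\<lambda>p::int. {(of_int p - \<rho>) / real k <..< (of_int p + \<rho>) / real k}"
  have fin: "finite ?P" by (simp add: int_interval_eq)
  have sub: "{\<alpha> \<in> {-R..R}. dist_int (real k * \<alpha>) < \<rho>} \<subseteq> (\<Union>p\<in>?P. ?I p)"
  proof
    fix \<alpha> assume "\<alpha> \<in> {\<alpha> \<in> {-R..R}. dist_int (real k * \<alpha>) < \<rho>}"
    then obtain p :: int where \<alpha>: "\<bar>\<alpha>\<bar> \<le> R" and p: "\<bar>real k * \<alpha> - of_int p\<bar> < \<rho>"
      by (auto simp: dist_int_less_iff abs_le_iff)
    have "\<bar>real k * \<alpha>\<bar> \<le> real k * R" using \<alpha> by (simp add: abs_mult mult_left_mono)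
    then have "p \<in> ?P" using p \<rho> by (simp add: abs_le_iff abs_less_iff)
    moreover have "\<alpha> \<in> ?I p" using p k by (simp add: abs_less_iff field_simps)
    ultimately show "\<alpha> \<in> (\<Union>p\<in>?P. ?I p)" by blast
  qed
  have I: "?I p \<in> fmeasurable lborel" "measure lborel (?I p) = 2 * \<rho> / real k" for p
    using k \<rho> by (auto simp: fmeasurable_def divide_right_mono diff_divide_distrib add_divide_distrib)
  have "measure lborel {\<alpha> \<in> {-R..R}. dist_int (real k * \<alpha>) < \<rho>} \<le> measure lborel (\<Union>p\<in>?P. ?I p)"
    by (intro measure_mono_fmeasurable sub fmeasurable.finite_UN fin I) measurable
  also have "\<dots> \<le> (\<Sum>p\<in>?P. measure lborel (?I p))"
    using fin I by (intro measure_UNION_le) auto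
  also have "\<dots> = real (card ?P) * (2 * \<rho> / real k)" by (simp add: I)
  also have "\<dots> \<le> (real k * (2 * R + 3)) * (2 * \<rho> / real k)"
  proof (intro mult_right_mono)
    have "0 \<le> real k * R" using R by simp
    then have "real (card ?P) \<le> (real k * R + 1) - (- (real k * R + 1)) + 1"
      by (intro card_int_interval_le) linarith
    also have "\<dots> \<le> real k * (2 * R + 3)" using k by (simp add: algebra_simps)
    finally show "real (card ?P) \<le> real k * (2 * R + 3)" .
  qed (use \<rho> in auto)
  also have "\<dots> = (2 * R + 3) * (2 * \<rho>)" using k by simp
  finally show ?thesis .
qed

text \<open>The approximation is to \<open>- 2 * \<alpha>\<close> because the partner \<open>n\<close> enters through \<open>z - 2 * \<alpha> * n\<close>.\<close>

definition good_multiplier :: "(nat \<Rightarrow> real) \<Rightarrow> real \<Rightarrow> bool" where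
  "good_multiplier \<delta> \<alpha> \<longleftrightarrow> (\<exists>q h. (\<forall>j. q j > 0 \<and> coprime (h j) (int (q j))
        \<and> \<bar>real (q j) * (- 2 * \<alpha>) - of_int (h j)\<bar> \<le> 1 / real (q j))
      \<and> (\<lambda>j. 1 / (real (q j) * \<delta> j)) \<longlonglongrightarrow> 0 \<and> (\<lambda>j. real (q j) / 2 ^ j) \<longlonglongrightarrow> 0)"

text \<open>Dirichlet's theorem at order about \<open>2 ^ j / sqrt (b j)\<close> yields a
  denominator, which can only fail by being at most \<open>sqrt (b j) / \<delta> j\<close>. There
  are at most that many bad denominators, each affecting a set of \<alpha> in a bounded interval of
  measure \<open>O(sqrt (b j) / 2 ^ j)\<close>. The products are summable, so Borel-Cantelli
  applies; the divergence of \<open>b\<close> gives both limits.\<close>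

lemma AE_good_multiplier:
  fixes \<delta> b :: "nat \<Rightarrow> real"
  assumes \<delta>: "\<And>j. \<delta> j > 0" and b: "\<And>j. b j > 0" and b_lim: "filterlim b at_top sequentially"
    and sm: "summable (\<lambda>j. b j / (2 ^ j * \<delta> j))"
  shows "AE \<alpha> in lborel. good_multiplier \<delta> \<alpha>"
proof -
  define Q where "Q j = nat \<lceil>2 ^ j / sqrt (b j)\<rceil>" for j
  have Qpos: "Q j > 0" for j using b[of j] by (simp add: Q_def)
  have Qge: "real (Q j) \<ge> 2 ^ j / sqrt (b j)" for j
    unfolding Q_def by (simp add: real_nat_ceiling_ge)
  have Qle: "real (Q j) \<le> 2 ^ j / sqrt (b j) + 1" for j
  proof -
    have "0 \<le> 2 ^ j / sqrt (b j)" using b[of j] by simp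
    then show ?thesis unfolding Q_def by linarith
  qed
  define K where "K j = {q::nat. 1 \<le> q \<and> real q \<le> sqrt (b j) / \<delta> j}" for j
  have K: "finite (K j)" "real (card (K j)) \<le> sqrt (b j) / \<delta> j" for j
  proof -
    have nn: "0 \<le> sqrt (b j) / \<delta> j" using b[of j] \<delta>[of j] by simp
    have "K j = {1..nat \<lfloor>sqrt (b j) / \<delta> j\<rfloor>}"
      using nn by (auto simp: K_def le_nat_iff le_floor_iff)
    then show "finite (K j)" "real (card (K j)) \<le> sqrt (b j) / \<delta> j" using nn by auto
  qed
  \<comment> \<open>Restricting to \<open>[-R, R]\<close> keeps the measures finite; the factor 2 in
    \<open>2 * q\<close> comes from approximating \<open>- 2 * \<alpha>\<close>.\<close>
  define A where "A R j = {\<alpha> \<in> {-real R..real R}. \<exists>q\<in>K j. dist_int (real (2 * q) * \<alpha>) < 1 / real (Q j)}"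
    for R j :: nat
  have A_eq: "A R j = (\<Union>q\<in>K j. {\<alpha> \<in> {-real R..real R}. dist_int (real (2 * q) * \<alpha>) < 1 / real (Q j)})"
    for R j by (auto simp: A_def)
  have A_sets: "A R j \<in> sets lborel" for R j
    unfolding A_eq using K by (intro sets.finite_UN) measurable
  have A_fin: "emeasure lborel (A R j) < \<infinity>" for R j
  proof -
    have "emeasure lborel (A R j) \<le> emeasure lborel {-real R..real R}"
      by (intro emeasure_mono) (auto simp: A_def)
    also have "\<dots> < \<infinity>" by simp
    finally show ?thesis .
  qed
  have A_le: "measure lborel (A R j) \<le> 2 * (2 * real R + 3) * (b j / (2 ^ j * \<delta> j))" for R j
  proof -
    have "measure lborel (A R j)
        \<le> (\<Sum>q\<in>K j. measure lborel {\<alpha> \<in> {-real R..real R}. dist_int (real (2 * q) * \<alpha>) < 1 / real (Q j)})"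
      unfolding A_eq using K by (intro measure_UNION_le) measurable
    also have "\<dots> \<le> (\<Sum>q\<in>K j. (2 * real R + 3) * (2 * (1 / real (Q j))))"
      using Qpos[of j] by (intro sum_mono measure_near_integer_multiple_le) (auto simp: K_def)
    also have "\<dots> = real (card (K j)) * ((2 * real R + 3) * (2 * (1 / real (Q j))))" by simp
    also have "\<dots> \<le> (sqrt (b j) / \<delta> j) * ((2 * real R + 3) * (2 * (sqrt (b j) / 2 ^ j)))"
    proof (intro mult_mono K)
      have "1 / real (Q j) \<le> 1 / (2 ^ j / sqrt (b j))"
        using Qge[of j] b[of j] by (intro divide_left_mono) (auto simp: Qpos)
      then show "1 / real (Q j) \<le> sqrt (b j) / 2 ^ j" by simp
    qed (use b[of j] \<delta>[of j] in auto)
    also have "\<dots> = 2 * (2 * real R + 3) * ((sqrt (b j))\<^sup>2 / (2 ^ j * \<delta> j))"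
      by (simp only: power2_eq_square times_divide_eq_left times_divide_eq_right divide_divide_eq_left mult_ac)
    also have "(sqrt (b j))\<^sup>2 = b j" using b[of j] by simp
    finally show ?thesis .
  qed
  have "AE \<alpha> in lborel. \<forall>\<^sub>F j in sequentially. \<alpha> \<in> space lborel - A R j" for R
  proof (rule borel_cantelli_AE1[OF A_sets A_fin])
    show "summable (\<lambda>j. measure lborel (A R j))"
      by (rule summable_comparison_test'[OF summable_mult[OF sm, of "2 * (2 * real R + 3)"], of 0])
        (use A_le in simp)
  qed
  then have "AE \<alpha> in lborel. \<forall>R. \<forall>\<^sub>F j in sequentially. \<alpha> \<in> space lborel - A R j"
    by (simp add: AE_all_countable)
  then show ?thesis
  proof (rule AE_mp, intro AE_I2 impI)
    fix \<alpha> :: real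
    assume *: "\<forall>R. \<forall>\<^sub>F j in sequentially. \<alpha> \<in> space lborel - A R j"
    obtain R :: nat where "\<bar>\<alpha>\<bar> \<le> real R" using real_arch_simple by blast
    then have "\<alpha> \<in> {-real R..real R}" by (auto simp: abs_le_iff)
    with * have ev: "\<forall>\<^sub>F j in sequentially. \<forall>q\<in>K j. \<not> dist_int (real (2 * q) * \<alpha>) < 1 / real (Q j)"
      by (auto simp: A_def elim!: allE[of _ R] eventually_mono)
    have "\<exists>q h. q > 0 \<and> q \<le> Q j \<and> coprime h (int q) \<and> \<bar>real q * (- 2 * \<alpha>) - of_int h\<bar> < 1 / real (Q j)" for j
    proof -
      obtain h k where hk: "coprime h k" "0 < k" "k \<le> int (Q j)"
        "\<bar>of_int k * (- 2 * \<alpha>) - of_int h\<bar> < 1 / real (Q j)"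
        using Dirichlet_approx_coprime[OF Qpos[of j], of "- 2 * \<alpha>"] by blast
      then show ?thesis by (intro exI[of _ "nat k"] exI[of _ h]) auto
    qed
    then obtain q h where qh: "\<And>j. q j > 0" "\<And>j. q j \<le> Q j" "\<And>j. coprime (h j) (int (q j))"
      "\<And>j. \<bar>real (q j) * (- 2 * \<alpha>) - of_int (h j)\<bar> < 1 / real (Q j)" by metis
    have approx: "\<bar>real (q j) * (- 2 * \<alpha>) - of_int (h j)\<bar> \<le> 1 / real (q j)" for j
    proof -
      have "1 / real (Q j) \<le> 1 / real (q j)" using qh(1,2)[of j] by (intro divide_left_mono) auto
      with qh(4)[of j] show ?thesis by linarith
    qed
    have inv_b: "(\<lambda>j. 1 / sqrt (b j)) \<longlonglongrightarrow> 0"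
      using filterlim_compose[OF sqrt_at_top b_lim]
      by (intro tendsto_divide_0[OF tendsto_const] filterlim_at_top_imp_at_infinity) simp
    have "(\<lambda>j. 1 / (real (q j) * \<delta> j)) \<longlonglongrightarrow> 0"
    proof (rule tendsto_sandwich[OF _ _ tendsto_const inv_b])
      show "\<forall>\<^sub>F j in sequentially. 0 \<le> 1 / (real (q j) * \<delta> j)"
        using \<delta> by (intro always_eventually allI) (simp add: less_imp_le)
      show "\<forall>\<^sub>F j in sequentially. 1 / (real (q j) * \<delta> j) \<le> 1 / sqrt (b j)"
        using ev
      proof eventually_elim
        case (elim j)
        \<comment> \<open>The Dirichlet denominator would put \<alpha> into the exceptional set if
          it belonged to \<open>K j\<close>, so it is large. The sign of
          \<open>- 2 * \<alpha>\<close> disappears because \<open>dist_int\<close> is even.\<close>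
        have "dist_int (- (real (2 * q j) * \<alpha>)) < 1 / real (Q j)"
          unfolding dist_int_less_iff using qh(4)[of j] by (intro exI[of _ "h j"]) (simp add: algebra_simps)
        then have "dist_int (real (2 * q j) * \<alpha>) < 1 / real (Q j)"
          by (simp add: dist_int_minus_less_iff)
        with elim have "q j \<notin> K j" by blast
        then have "sqrt (b j) / \<delta> j < real (q j)" using qh(1)[of j] by (auto simp: K_def Suc_le_eq)
        then have "sqrt (b j) \<le> real (q j) * \<delta> j" using \<delta>[of j] by (simp add: field_simps)
        then show ?case using b[of j] \<delta>[of j] qh(1)[of j] by (intro divide_left_mono) auto
      qed
    qed
    moreover have "(\<lambda>j. real (q j) / 2 ^ j) \<longlonglongrightarrow> 0"
    proof (rule tendsto_sandwich[OF _ _ tendsto_const])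
      show "(\<lambda>j. 1 / sqrt (b j) + (1 / 2) ^ j) \<longlonglongrightarrow> 0"
        using tendsto_add[OF inv_b LIMSEQ_power_zero[of "1 / 2 :: real"]] by simp
      have "real (q j) / 2 ^ j \<le> 1 / sqrt (b j) + (1 / 2) ^ j" for j
      proof -
        have "real (q j) / 2 ^ j \<le> (2 ^ j / sqrt (b j) + 1) / 2 ^ j"
          using qh(2)[of j] Qle[of j] by (intro divide_right_mono) auto
        then show ?thesis by (simp add: add_divide_distrib power_one_over)
      qed
      then show "\<forall>\<^sub>F j in sequentially. real (q j) / 2 ^ j \<le> 1 / sqrt (b j) + (1 / 2) ^ j" by simp
    qed simp
    ultimately show "good_multiplier \<delta> \<alpha>"
      unfolding good_multiplier_def using qh(1,3) approx by blast
  qed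
qed

section \<open>Second moments of pair sums of independent variables\<close>

locale iid_sequence = U: prob_space U for U :: "'a measure"
begin

abbreviation iid :: "(nat \<Rightarrow> 'a) measure" where
  "iid \<equiv> (\<Pi>\<^sub>M i\<in>UNIV. U)"

sublocale iid: prob_space iid
  by (intro prob_space_PiM U.prob_space_axioms)

sublocale U_iid: pair_sigma_finite U iid ..

text \<open>Redrawing coordinate \<open>i\<close> independently leaves the product measure
  invariant, so Fubini lets one coordinate be integrated first with all others frozen.\<close>

lemma integral_resample:
  fixes F :: "(nat \<Rightarrow> 'a) \<Rightarrow> real"
  assumes F [measurable]: "F \<in> borel_measurable iid" and B: "\<And>u. \<bar>F u\<bar> \<le> B"
  shows "(\<integral>u. F u \<partial>iid) = (\<integral>u. (\<integral>x. F (u(i := x)) \<partial>U) \<partial>iid)"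
proof -
  interpret UP: prob_space "U \<Otimes>\<^sub>M iid"
    by (intro prob_space_pair U.prob_space_axioms iid.prob_space_axioms)
  have eq: "distr (U \<Otimes>\<^sub>M iid) iid (\<lambda>(x, X). X(i := x)) = iid"
    using distr_pair_PiM_eq_PiM[of UNIV "\<lambda>_. U" i] U.prob_space_axioms by simp
  have m [measurable]: "(\<lambda>(x, X). X(i := x)) \<in> measurable (U \<Otimes>\<^sub>M iid) iid"
    unfolding split_beta by (rule measurable_fun_upd[where J = UNIV]) auto
  have "(\<integral>u. F u \<partial>iid) = (\<integral>u. F u \<partial>distr (U \<Otimes>\<^sub>M iid) iid (\<lambda>(x, X). X(i := x)))"
    by (simp only: eq)
  also have "\<dots> = (\<integral>z. F ((\<lambda>(x, X). X(i := x)) z) \<partial>(U \<Otimes>\<^sub>M iid))"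
    by (rule integral_distr[OF m F])
  also have "\<dots> = (\<integral>z. (\<lambda>(x, u). F (u(i := x))) z \<partial>(U \<Otimes>\<^sub>M iid))"
    by (simp add: split_beta)
  also have "\<dots> = (\<integral>u. (\<integral>x. F (u(i := x)) \<partial>U) \<partial>iid)"
  proof (rule U_iid.integral_snd[symmetric], rule UP.integrable_const_bound[where B = B])
    have "(\<lambda>z. F ((\<lambda>(x, X). X(i := x)) z)) \<in> borel_measurable (U \<Otimes>\<^sub>M iid)" by measurable
    then show "(\<lambda>(x, u). F (u(i := x))) \<in> borel_measurable (U \<Otimes>\<^sub>M iid)"
      by (simp add: split_beta)
  qed (use B in auto)
  finally show ?thesis .
qed

lemma integrable_bounded:
  fixes F :: "(nat \<Rightarrow> 'a) \<Rightarrow> real"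
  assumes "F \<in> borel_measurable iid" "\<And>u. \<bar>F u\<bar> \<le> B"
  shows "integrable iid F"
  using assms by (intro iid.integrable_const_bound[where B = B]) auto

text \<open>Subtracting from each kernel its mean over the variable with the smaller index makes terms with
  different smaller indices orthogonal.\<close>

lemma second_moment_pair_sum:
  fixes A :: "nat \<Rightarrow> nat \<Rightarrow> 'a \<Rightarrow> 'a \<Rightarrow> real" and N :: nat and C :: real
  assumes meas: "\<And>m n. (\<lambda>(x, y). A m n x y) \<in> borel_measurable (U \<Otimes>\<^sub>M U)"
    and A01: "\<And>m n x y. 0 \<le> A m n x y" "\<And>m n x y. A m n x y \<le> 1"
    and C: "\<And>n y. n \<in> {1..N} \<Longrightarrow> (\<Sum>m\<in>{n<..N}. \<integral>x. A m n x y \<partial>U) \<le> C"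
  defines "D \<equiv> \<lambda>u. \<Sum>n\<in>{1..N}. \<Sum>m\<in>{n<..N}. A m n (u m) (u n) - (\<integral>y. A m n (u m) y \<partial>U)"
  shows "D \<in> borel_measurable iid" and "\<exists>B. \<forall>u. \<bar>D u\<bar> \<le> B"
    and "(\<integral>u. (D u)\<^sup>2 \<partial>iid) \<le> real N * (C\<^sup>2 + C)"
proof -
  \<comment> \<open>\<open>f\<close> averages out the smaller-indexed variable and serves as the
    centering; \<open>g\<close> averages out the larger-indexed one and is what \<open>C\<close>
    bounds.\<close>
  define f where "f m n x = (\<integral>y. A m n x y \<partial>U)" for m n x
  define g where "g m n y = (\<integral>x. A m n x y \<partial>U)" for m n y
  define B where "B m n u = A m n (u m) (u n) - f m n (u m)" for m n and u :: "nat \<Rightarrow> 'a"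
  define H where "H n u = (\<Sum>m\<in>{n<..N}. B m n u)" for n u
  have D: "D u = (\<Sum>n\<in>{1..N}. H n u)" for u
    by (simp add: D_def H_def B_def f_def)

  \<comment> \<open>Measurability and boundedness of the kernels and their means\<close>
  have comp [measurable]: "(\<lambda>u. u k) \<in> measurable iid U" for k
    by (rule measurable_component_singleton) simp
  have A_x [measurable]: "(\<lambda>y. A m n x y) \<in> borel_measurable U" if "x \<in> space U" for m n x
    using measurable_compose[OF measurable_Pair1'[OF that] meas[of m n]] by simp
  have A_meas [measurable]: "(\<lambda>u. A m n (u k) (u l)) \<in> borel_measurable iid" for m n k l
    using measurable_compose[OF measurable_Pair[OF comp[of k] comp[of l]] meas[of m n]] by simp
  have f_meas [measurable]: "f m n \<in> borel_measurable U" for m n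
    unfolding f_def[abs_def] by (rule U.borel_measurable_lebesgue_integral[OF meas])
  have swap: "(\<lambda>(y, x). A m n x y) \<in> borel_measurable (U \<Otimes>\<^sub>M U)" for m n
    using measurable_compose[OF measurable_pair_swap' meas[of m n]] by (simp add: split_beta)
  have g_meas [measurable]: "g m n \<in> borel_measurable U" for m n
    unfolding g_def[abs_def] by (rule U.borel_measurable_lebesgue_integral[OF swap])
  have B_meas [measurable]: "B m n \<in> borel_measurable iid" for m n
    unfolding B_def[abs_def] by measurable
  have int_A_x: "integrable U (\<lambda>y. A m n x y)" if "x \<in> space U" for m n x
    using A01 that by (intro U.integrable_const_bound[where B = 1]) auto
  have mean01: "0 \<le> (\<integral>x. F x \<partial>U)" "(\<integral>x. F x \<partial>U) \<le> 1" if "\<And>x. 0 \<le> F x" "\<And>x. F x \<le> (1::real)" for F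
  proof -
    show "0 \<le> (\<integral>x. F x \<partial>U)" using that by simp
    show "(\<integral>x. F x \<partial>U) \<le> 1"
    \<comment> \<open>A nonintegrable \<open>F\<close> has integral 0 by convention, which also
      satisfies the bound.\<close>
    proof (cases "integrable U F")
      case True
      then show ?thesis using that U.integral_le_const[of F 1] by auto
    qed (simp add: not_integrable_integral_eq)
  qed
  have f01: "0 \<le> f m n x" "f m n x \<le> 1" for m n x
    unfolding f_def using A01 by (auto intro!: mean01)
  have g01: "0 \<le> g m n y" "g m n y \<le> 1" for m n y
    unfolding g_def using A01 by (auto intro!: mean01)
  have B1: "\<bar>B m n u\<bar> \<le> 1" for m n u
    using A01[of m n "u m" "u n"] f01[of m n "u m"] by (simp add: B_def abs_le_iff)
  have H1: "\<bar>H n u\<bar> \<le> real N" for n u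
  proof -
    have "\<bar>H n u\<bar> \<le> (\<Sum>m\<in>{n<..N}. 1)"
      unfolding H_def by (rule order_trans[OF sum_abs]) (intro sum_mono B1)
    then show ?thesis by simp
  qed
  have H_meas [measurable]: "H n \<in> borel_measurable iid" for n
    unfolding H_def[abs_def] by measurable
  show D_meas [measurable]: "D \<in> borel_measurable iid"
    unfolding D[abs_def] by measurable
  have "\<bar>D u\<bar> \<le> real N * real N" for u
  proof -
    have "\<bar>D u\<bar> \<le> (\<Sum>n\<in>{1..N}. real N)"
      unfolding D by (rule order_trans[OF sum_abs]) (intro sum_mono H1)
    then show ?thesis by simp
  qed
  then show "\<exists>B. \<forall>u. \<bar>D u\<bar> \<le> B" by blast

  \<comment> \<open>Covariances of the centered kernels\<close>
  have BB1: "\<bar>B m n u * B m' n' u\<bar> \<le> 1" for m n m' n' u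
    using mult_mono[OF B1[of m n u] B1[of m' n' u]] by (simp add: abs_mult)
  have int_BB: "integrable iid (\<lambda>u. B m n u * B m' n' u)" for m n m' n'
    by (rule integrable_bounded[where B = 1]) (use BB1 in auto)
  have HH1: "\<bar>H n u * H n' u\<bar> \<le> real N * real N" for n n' u
    using mult_mono[OF H1[of n u] H1[of n' u]] by (simp add: abs_mult)
  have int_HH: "integrable iid (\<lambda>u. H n u * H n' u)" for n n'
    by (rule integrable_bounded[where B = "real N * real N"]) (use HH1 in auto)
  have space_iid: "u k \<in> space U" if "u \<in> space iid" for u k
    using that by (auto simp: space_PiM PiE_iff)

  \<comment> \<open>Coordinate \<open>n\<close> enters only the first factor, as the variable over
    which \<open>B m n\<close> is centered, so averaging over it gives 0.\<close>
  have orth0: "(\<integral>u. B m n u * B m' n' u \<partial>iid) = 0"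
    if "n < m" "n' < m'" "n \<noteq> n'" "n \<noteq> m'" for m n m' n'
  proof -
    have "(\<integral>u. B m n u * B m' n' u \<partial>iid)
        = (\<integral>u. (\<integral>y. B m n (u(n := y)) * B m' n' (u(n := y)) \<partial>U) \<partial>iid)"
      by (rule integral_resample[where B = 1]) (use BB1 in auto)
    also have "\<dots> = (\<integral>u. 0 \<partial>iid)"
    proof (rule Bochner_Integration.integral_cong[OF refl])
      fix u assume u: "u \<in> space iid"
      have "(\<integral>y. B m n (u(n := y)) * B m' n' (u(n := y)) \<partial>U)
          = (\<integral>y. (A m n (u m) y - f m n (u m)) * B m' n' u \<partial>U)"
        using that by (simp add: B_def)
      also have "\<dots> = 0"
        using int_A_x[OF space_iid[OF u], of m n m]
        by (simp add: f_def U.prob_space)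
      finally show "(\<integral>y. B m n (u(n := y)) * B m' n' (u(n := y)) \<partial>U) = 0" .
    qed
    finally show ?thesis by simp
  qed
  have orth: "(\<integral>u. B m n u * B m' n' u \<partial>iid) = 0"
    if "n < m" "n' < m'" "n \<noteq> n'" for m n m' n'
  proof (cases "n = m'")
    \<comment> \<open>Here \<open>n' < m' = n < m\<close>, so \<open>n'\<close> is a coordinate
      occurring in only one factor and the roles are exchanged.\<close>
    case True
    then have "(\<integral>u. B m' n' u * B m n u \<partial>iid) = 0" using that by (intro orth0) auto
    then show ?thesis by (simp add: mult.commute)
  qed (use that in \<open>intro orth0\<close>)

  \<comment> \<open>After averaging over coordinate \<open>n\<close>, centering subtracts a
    nonnegative product of two values of \<open>f\<close>; dropping it leaves the uncentered
    kernels.\<close>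
  have diag0: "(\<integral>u. B m n u * B m' n u \<partial>iid)
      \<le> (\<integral>u. A m n (u m) (u n) * A m' n (u m') (u n) \<partial>iid)" (is "?l \<le> ?r")
    if "n < m" "n < m'" for m n m'
  proof -
    have AA1: "\<bar>A m n x y * A m' n x' y\<bar> \<le> 1" for x x' y
      using mult_mono[OF A01(2)[of m n x y] A01(2)[of m' n x' y]] A01 by simp
    have "?r = (\<integral>u. (\<integral>y. A m n (u m) y * A m' n (u m') y \<partial>U) \<partial>iid)"
      using that
      by (subst integral_resample[where B = 1 and i = n]) (use AA1 in auto)
    moreover have "?l = (\<integral>u. (\<integral>y. A m n (u m) y * A m' n (u m') y \<partial>U) - f m n (u m) * f m' n (u m') \<partial>iid)"
    proof -
      have "?l = (\<integral>u. (\<integral>y. B m n (u(n := y)) * B m' n (u(n := y)) \<partial>U) \<partial>iid)"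
        by (rule integral_resample[where B = 1]) (use BB1 in auto)
      also have "\<dots> = (\<integral>u. (\<integral>y. A m n (u m) y * A m' n (u m') y \<partial>U) - f m n (u m) * f m' n (u m') \<partial>iid)"
      proof (rule Bochner_Integration.integral_cong[OF refl])
        fix u assume u: "u \<in> space iid"
        note sp = space_iid[OF u]
        have i: "integrable U (\<lambda>y. A m n (u m) y * A m' n (u m') y)"
          using AA1 sp by (intro U.integrable_const_bound[where B = 1]) auto
        have "(\<integral>y. B m n (u(n := y)) * B m' n (u(n := y)) \<partial>U)
          = (\<integral>y. A m n (u m) y * A m' n (u m') y - f m' n (u m') * A m n (u m) y
              - f m n (u m) * A m' n (u m') y + f m n (u m) * f m' n (u m') \<partial>U)"
          using that by (simp add: B_def algebra_simps)
        also have "\<dots> = (\<integral>y. A m n (u m) y * A m' n (u m') y \<partial>U) - f m n (u m) * f m' n (u m')"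
          using i int_A_x[OF sp, of m n m] int_A_x[OF sp, of m' n m']
          by (simp add: f_def[symmetric] U.prob_space)
        finally show "(\<integral>y. B m n (u(n := y)) * B m' n (u(n := y)) \<partial>U)
          = (\<integral>y. A m n (u m) y * A m' n (u m') y \<partial>U) - f m n (u m) * f m' n (u m')" .
      qed
      finally show ?thesis .
    qed
    moreover have "\<dots> \<le> (\<integral>u. (\<integral>y. A m n (u m) y * A m' n (u m') y \<partial>U) \<partial>iid)"
    proof (rule integral_mono)
      have meas2: "(\<lambda>(u, y). A m n (u m) y * A m' n (u m') y) \<in> borel_measurable (iid \<Otimes>\<^sub>M U)"
      proof -
        have "(\<lambda>z. A k n (fst z k) (snd z)) \<in> borel_measurable (iid \<Otimes>\<^sub>M U)" for k
          using measurable_compose[OF measurable_Pair[OF measurable_compose[OF measurable_fst comp[of k]]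
              measurable_snd] meas[of k n]] by simp
        then show ?thesis by (simp add: split_beta)
      qed
      have i1: "integrable iid (\<lambda>u. \<integral>y. A m n (u m) y * A m' n (u m') y \<partial>U)"
      proof (rule integrable_bounded[where B = 1])
        show "(\<lambda>u. \<integral>y. A m n (u m) y * A m' n (u m') y \<partial>U) \<in> borel_measurable iid"
          by (rule U.borel_measurable_lebesgue_integral[OF meas2])
        show "\<bar>\<integral>y. A m n (u m) y * A m' n (u m') y \<partial>U\<bar> \<le> 1" for u :: "nat \<Rightarrow> 'a"
          using mean01[of "\<lambda>y. A m n (u m) y * A m' n (u m') y"] AA1[of "u m" _ "u m'"] A01 by simp
      qed
      show "integrable iid (\<lambda>u. \<integral>y. A m n (u m) y * A m' n (u m') y \<partial>U)" by (rule i1)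
      have "integrable iid (\<lambda>u. f m n (u m) * f m' n (u m'))"
        using f01 by (intro integrable_bounded[where B = 1]) (auto intro: mult_le_one)
      with i1 show "integrable iid (\<lambda>u. (\<integral>y. A m n (u m) y * A m' n (u m') y \<partial>U) - f m n (u m) * f m' n (u m'))"
        by (rule Bochner_Integration.integrable_diff)
    qed (use f01 in simp)
    ultimately show ?thesis by simp
  qed

  \<comment> \<open>For \<open>m \<noteq> m'\<close> the two larger-indexed variables are integrated
    out separately. For \<open>m = m'\<close> the product is at most the kernel itself, which costs
    one extra \<open>g\<close>; the added \<open>g * g\<close> is nonnegative and completes the
    double sum to a square.\<close>
  have diag: "(\<integral>u. B m n u * B m' n u \<partial>iid)
      \<le> (\<integral>u. g m n (u n) * g m' n (u n) + (if m = m' then g m n (u n) else 0) \<partial>iid)"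
    if mn: "n < m" "n < m'" for m n m'
  proof (rule order_trans[OF diag0[OF mn]])
    have ig: "integrable iid (\<lambda>u. g m n (u n))"
      "integrable iid (\<lambda>u. g m n (u n) * g m' n (u n))"
      using g01 by (intro integrable_bounded[where B = 1]; auto intro: mult_le_one)+
    show "(\<integral>u. A m n (u m) (u n) * A m' n (u m') (u n) \<partial>iid)
      \<le> (\<integral>u. g m n (u n) * g m' n (u n) + (if m = m' then g m n (u n) else 0) \<partial>iid)"
    proof (cases "m = m'")
      case False
      have "(\<integral>u. A m n (u m) (u n) * A m' n (u m') (u n) \<partial>iid)
          = (\<integral>u. g m n (u n) * A m' n (u m') (u n) \<partial>iid)"
        using mn False A01
        by (subst integral_resample[where B = 1 and i = m]) (auto intro: mult_le_one simp: g_def[symmetric])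
      also have "\<dots> = (\<integral>u. g m n (u n) * g m' n (u n) \<partial>iid)"
        using mn False A01 g01
        by (subst integral_resample[where B = 1 and i = m']) (auto intro: mult_le_one simp: g_def[symmetric])
      finally show ?thesis using False by simp
    next
      case True
      have "(\<integral>u. A m n (u m) (u n) * A m' n (u m') (u n) \<partial>iid) \<le> (\<integral>u. A m n (u m) (u n) \<partial>iid)"
        using A01 True
        by (intro integral_mono integrable_bounded[where B = 1]) (auto intro: mult_le_one mult_left_le)
      also have "\<dots> = (\<integral>u. g m n (u n) \<partial>iid)"
        using mn A01 by (subst integral_resample[where B = 1 and i = m]) (auto simp: g_def[symmetric])
      also have "\<dots> \<le> (\<integral>u. g m n (u n) * g m' n (u n) + g m n (u n) \<partial>iid)"
        using ig g01 by (intro integral_mono) auto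
      finally show ?thesis using True by simp
    qed
  qed

  \<comment> \<open>Summed over \<open>m\<close> and \<open>m'\<close>, the diagonal bounds form a
    square plus a single sum, so the hypothesis on \<open>C\<close> applies pointwise.\<close>
  have Hn: "(\<integral>u. H n u * H n u \<partial>iid) \<le> C\<^sup>2 + C" if n: "n \<in> {1..N}" for n
  proof -
    let ?G = "\<lambda>m m' u. g m n (u n) * g m' n (u n) + (if m = m' then g m n (u n) else 0)"
    have iG: "integrable iid (\<lambda>u. ?G m m' u)" for m m'
    proof (intro Bochner_Integration.integrable_add)
      show "integrable iid (\<lambda>u. g m n (u n) * g m' n (u n))"
        using g01 by (intro integrable_bounded[where B = 1]) (auto intro: mult_le_one)
      show "integrable iid (\<lambda>u. if m = m' then g m n (u n) else 0)"
        using g01 by (intro integrable_bounded[where B = 1]) auto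
    qed
    have "(\<integral>u. H n u * H n u \<partial>iid) = (\<Sum>m\<in>{n<..N}. \<Sum>m'\<in>{n<..N}. \<integral>u. B m n u * B m' n u \<partial>iid)"
      unfolding H_def sum_product using int_BB by (simp add: Bochner_Integration.integral_sum)
    also have "\<dots> \<le> (\<Sum>m\<in>{n<..N}. \<Sum>m'\<in>{n<..N}. \<integral>u. ?G m m' u \<partial>iid)"
      by (intro sum_mono diag) auto
    also have "\<dots> = (\<integral>u. (\<Sum>m\<in>{n<..N}. \<Sum>m'\<in>{n<..N}. ?G m m' u) \<partial>iid)"
      using iG by (simp add: Bochner_Integration.integral_sum)
    also have "\<dots> = (\<integral>u. (\<Sum>m\<in>{n<..N}. g m n (u n))\<^sup>2 + (\<Sum>m\<in>{n<..N}. g m n (u n)) \<partial>iid)"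
      by (simp add: sum.distrib power2_eq_square sum_product sum.delta')
    also have "\<dots> \<le> C\<^sup>2 + C"
    proof (rule iid.integral_le_const)
      have *: "integrable iid (\<lambda>u. \<Sum>m\<in>{n<..N}. \<Sum>m'\<in>{n<..N}. ?G m m' u)"
        using iG by (intro Bochner_Integration.integrable_sum)
      then show "integrable iid (\<lambda>u. (\<Sum>m\<in>{n<..N}. g m n (u n))\<^sup>2 + (\<Sum>m\<in>{n<..N}. g m n (u n)))"
        by (simp add: sum.distrib power2_eq_square sum_product sum.delta')
      have "(\<Sum>m\<in>{n<..N}. g m n y) \<le> C" for y
        using C[OF n, of y] by (simp add: g_def)
      moreover have "0 \<le> (\<Sum>m\<in>{n<..N}. g m n y)" for y
        by (intro sum_nonneg g01)
      ultimately show "AE u in iid. (\<Sum>m\<in>{n<..N}. g m n (u n))\<^sup>2 + (\<Sum>m\<in>{n<..N}. g m n (u n)) \<le> C\<^sup>2 + C"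
        by (intro AE_I2 add_mono power_mono)
    qed
    finally show ?thesis .
  qed
  have off: "(\<integral>u. H n u * H n' u \<partial>iid) = 0" if "n \<noteq> n'" for n n'
  proof -
    have "(\<integral>u. H n u * H n' u \<partial>iid) = (\<Sum>m\<in>{n<..N}. \<Sum>m'\<in>{n'<..N}. \<integral>u. B m n u * B m' n' u \<partial>iid)"
      unfolding H_def sum_product using int_BB by (simp add: Bochner_Integration.integral_sum)
    also have "\<dots> = 0" using that by (intro sum.neutral ballI orth) auto
    finally show ?thesis .
  qed
  have "(\<integral>u. (D u)\<^sup>2 \<partial>iid) = (\<Sum>n\<in>{1..N}. \<Sum>n'\<in>{1..N}. \<integral>u. H n u * H n' u \<partial>iid)"
    unfolding D power2_eq_square sum_product using int_HH by (simp add: Bochner_Integration.integral_sum)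
  also have "\<dots> = (\<Sum>n\<in>{1..N}. \<Sum>n'\<in>{1..N}. if n = n' then \<integral>u. H n u * H n' u \<partial>iid else 0)"
    by (intro sum.cong refl) (simp add: off)
  also have "\<dots> = (\<Sum>n\<in>{1..N}. \<integral>u. H n u * H n u \<partial>iid)"
    by (intro sum.cong refl) (simp add: sum.delta)
  also have "\<dots> \<le> (\<Sum>n\<in>{1..N}. C\<^sup>2 + C)"
    by (intro sum_mono Hn)
  finally show "(\<integral>u. (D u)\<^sup>2 \<partial>iid) \<le> real N * (C\<^sup>2 + C)" by simp
qed

end

section \<open>Pair counts and additive energy\<close>

definition pair_count :: "(nat \<Rightarrow> real) \<Rightarrow> nat \<Rightarrow> real \<Rightarrow> nat" where
  "pair_count y N s = card {(m, n). m \<in> {1..N} \<and> n \<in> {1..N} \<and> m \<noteq> n \<and> dist_int (y m - y n) < s / real N}"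

section \<open>Passing from squares to all \<open>N\<close>\<close>

lemma pair_count_mono:
  assumes "N \<le> N'" and "s / real N \<le> s' / real N'"
  shows "pair_count y N s \<le> pair_count y N' s'"
  unfolding pair_count_def
proof (rule card_mono)
  show "finite {(m, n). m \<in> {1..N'} \<and> n \<in> {1..N'} \<and> m \<noteq> n \<and> dist_int (y m - y n) < s' / real N'}"
    by (rule finite_subset[of _ "{1..N'} \<times> {1..N'}"]) auto
qed (use assms in fastforce)

text \<open>Pair counts grow with \<open>N\<close> and with the window, and the ratio of consecutive
  squares tends to 1, so a rational \<open>s'\<close> slightly above or below \<open>s\<close>
  absorbs the gap between squares. Rational windows leave only countably many almost sure events to
  establish.\<close>

lemma poissonian_pc_from_squares:
  assumes lim: "\<And>s. s \<in> \<rat> \<Longrightarrow> s > 0 \<Longrightarrow> (\<lambda>k. real (pair_count y (k\<^sup>2) s) / real (k\<^sup>2)) \<longlonglongrightarrow> 2 * s"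
  shows "poissonian_pc y"
  unfolding poissonian_pc_def pair_count_def[symmetric]
proof (intro allI impI)
  fix s :: real assume s: "s > 0"
  have fsq: "filterlim floor_sqrt at_top sequentially"
    unfolding filterlim_at_top
  proof
    fix Z :: nat
    show "\<forall>\<^sub>F N in sequentially. Z \<le> floor_sqrt N"
      using eventually_ge_at_top[of "Z\<^sup>2"] by eventually_elim (simp add: le_floor_sqrt_iff)
  qed
  have fsq': "filterlim (\<lambda>N. Suc (floor_sqrt N)) at_top sequentially"
    using filterlim_compose[OF filterlim_Suc fsq] .
  define r :: "nat \<Rightarrow> real" where "r k = (real (Suc k))\<^sup>2 / (real k)\<^sup>2" for k
  have r: "r \<longlonglongrightarrow> 1" unfolding r_def by real_asymp
  have r': "(\<lambda>k. 1 / r k) \<longlonglongrightarrow> 1" using tendsto_divide[OF tendsto_const r, of 1] by simp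
  have bounds: "(floor_sqrt N)\<^sup>2 \<le> N" "N \<le> (Suc (floor_sqrt N))\<^sup>2" for N
    using Suc_floor_sqrt_power2_gt[of N] by auto
  have pos: "\<forall>\<^sub>F N in sequentially. floor_sqrt N > 0"
    using eventually_ge_at_top[of 1] by eventually_elim simp
  show "(\<lambda>N. real (pair_count y N s) / real N) \<longlonglongrightarrow> 2 * s"
  proof (rule order_tendstoI)
    fix a :: real assume a: "2 * s < a"
    obtain s' where s': "s' \<in> \<rat>" "s < s'" "s' < a / 2"
      using Rats_dense_in_real[of s "a / 2"] a by auto
    have "(\<lambda>N. real (pair_count y ((Suc (floor_sqrt N))\<^sup>2) s') / real ((Suc (floor_sqrt N))\<^sup>2) * r (floor_sqrt N))
        \<longlonglongrightarrow> 2 * s' * 1"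
      using s s' by (intro tendsto_mult filterlim_compose[OF lim fsq'] filterlim_compose[OF r fsq]) auto
    then have 1: "\<forall>\<^sub>F N in sequentially. real (pair_count y ((Suc (floor_sqrt N))\<^sup>2) s')
        / real ((Suc (floor_sqrt N))\<^sup>2) * r (floor_sqrt N) < a"
      by (rule order_tendstoD) (use s' in simp)
    have "(\<lambda>N. s * r (floor_sqrt N)) \<longlonglongrightarrow> s * 1"
      by (intro tendsto_mult tendsto_const filterlim_compose[OF r fsq])
    then have 2: "\<forall>\<^sub>F N in sequentially. s * r (floor_sqrt N) < s'"
      by (rule order_tendstoD) (use s' in simp)
    show "\<forall>\<^sub>F N in sequentially. real (pair_count y N s) / real N < a"
      using 1 2 pos
    proof eventually_elim
      case (elim N)
      define k where "k = floor_sqrt N"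
      have k: "real k > 0" "real (k\<^sup>2) \<le> real N" "real N \<le> real ((Suc k)\<^sup>2)"
        using elim(3) bounds[of N] by (auto simp only: k_def of_nat_0_less_iff of_nat_le_iff)
      have N: "real N > 0" using k(1,2) by (metis less_le_trans of_nat_0_less_iff zero_less_power)
      \<comment> \<open>The window \<open>s / N\<close> must fit into the window of parameter
        \<open>s'\<close> at the next square; it does once the ratio of the squares is below
        \<open>s' / s\<close>.\<close>
      have "s * real ((Suc k)\<^sup>2) \<le> s' * real (k\<^sup>2)"
        using elim(2) k(1) by (simp add: r_def k_def[symmetric] field_simps)
      also have "\<dots> \<le> s' * real N" using k s s' by (intro mult_left_mono) auto
      finally have "s / real N \<le> s' / real ((Suc k)\<^sup>2)"
        using N by (simp add: field_simps del: of_nat_power)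
      then have "pair_count y N s \<le> pair_count y ((Suc k)\<^sup>2) s'"
        using bounds(2)[of N] by (intro pair_count_mono) (auto simp: k_def)
      then have "real (pair_count y N s) / real N \<le> real (pair_count y ((Suc k)\<^sup>2) s') / real (k\<^sup>2)"
        using k N by (intro frac_le) auto
      also have "\<dots> = real (pair_count y ((Suc k)\<^sup>2) s') / real ((Suc k)\<^sup>2) * r k"
        by (simp add: r_def del: of_nat_Suc)
      finally show ?case using elim(1) by (simp add: k_def)
    qed
  next
    fix a :: real assume a: "a < 2 * s"
    \<comment> \<open>The \<open>max 0\<close> keeps \<open>s'\<close> positive when
      \<open>a\<close> is negative.\<close>
    obtain s' where s': "s' \<in> \<rat>" "max 0 (a / 2) < s'" "s' < s"
      using Rats_dense_in_real[of "max 0 (a / 2)" s] a s by auto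
    have "(\<lambda>N. real (pair_count y ((floor_sqrt N)\<^sup>2) s') / real ((floor_sqrt N)\<^sup>2) * (1 / r (floor_sqrt N)))
        \<longlonglongrightarrow> 2 * s' * 1"
      using s s' by (intro tendsto_mult filterlim_compose[OF lim fsq] filterlim_compose[OF r' fsq]) auto
    then have 1: "\<forall>\<^sub>F N in sequentially. a < real (pair_count y ((floor_sqrt N)\<^sup>2) s')
        / real ((floor_sqrt N)\<^sup>2) * (1 / r (floor_sqrt N))"
      by (rule order_tendstoD) (use s' in simp)
    have "(\<lambda>N. s' * r (floor_sqrt N)) \<longlonglongrightarrow> s' * 1"
      by (intro tendsto_mult tendsto_const filterlim_compose[OF r fsq])
    then have 2: "\<forall>\<^sub>F N in sequentially. s' * r (floor_sqrt N) < s"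
      by (rule order_tendstoD) (use s' in simp)
    show "\<forall>\<^sub>F N in sequentially. a < real (pair_count y N s) / real N"
      using 1 2 pos
    proof eventually_elim
      case (elim N)
      define k where "k = floor_sqrt N"
      have k: "real k > 0" "real (k\<^sup>2) \<le> real N" "real N \<le> real ((Suc k)\<^sup>2)"
        using elim(3) bounds[of N] by (auto simp only: k_def of_nat_0_less_iff of_nat_le_iff)
      have N: "real N > 0" using k(1,2) by (metis less_le_trans of_nat_0_less_iff zero_less_power)
      have "s' * real N \<le> s' * real ((Suc k)\<^sup>2)" using k s s' by (intro mult_left_mono) auto
      also have "\<dots> \<le> s * real (k\<^sup>2)"
        using elim(2) k(1) by (simp add: r_def k_def[symmetric] field_simps)
      finally have "s' / real (k\<^sup>2) \<le> s / real N"
        using N k(1) by (simp add: field_simps)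
      then have "pair_count y (k\<^sup>2) s' \<le> pair_count y N s"
        using bounds(1)[of N] by (intro pair_count_mono) (auto simp: k_def)
      then have le: "real (pair_count y (k\<^sup>2) s') / real ((Suc k)\<^sup>2) \<le> real (pair_count y N s) / real N"
        using k N by (intro frac_le) auto
      have "a < real (pair_count y (k\<^sup>2) s') / real (k\<^sup>2) * (1 / r k)"
        using elim(1) by (simp only: k_def)
      also have "\<dots> = real (pair_count y (k\<^sup>2) s') / real ((Suc k)\<^sup>2)"
        using k(1) by (simp add: r_def del: of_nat_Suc)
      also note le
      finally show ?case .
    qed
  qed
qed

text \<open>The dyadic block \<open>[2 * h, 4 * h)\<close> lies below \<open>N\<close> and has a
  single amplitude, so exact solutions of \<open>a + b = c + d\<close> in it are spoiled by at most
  twice that amplitude. There are at least \<open>h ^ 3\<close> of them, and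
  \<open>N < 8 * h\<close> gives the constant \<open>1 / 512\<close>.\<close>

lemma add_energy_ge:
  fixes \<delta> :: "nat \<Rightarrow> real" and v :: "nat \<Rightarrow> real"
  assumes \<delta>: "\<And>j. \<delta> j \<ge> 0" and v: "\<And>n. 0 \<le> v n" "\<And>n. v n \<le> 1"
    and N: "N \<ge> 4" and \<gamma>: "2 * \<delta> (floor_log N - 1) < \<gamma>"
  shows "real (add_energy (\<lambda>n. 2 * real n + \<delta> (floor_log n) * v n) N \<gamma>) \<ge> 1 / 512 * real N ^ 3"
proof -
  define x where "x n = 2 * real n + \<delta> (floor_log n) * v n" for n
  define j where "j = floor_log N"
  have j2: "j \<ge> 2" using floor_log_le_iff[OF N] floor_log_power[of 2] by (simp add: j_def)
  define h :: nat where "h = 2 ^ (j - 2)"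
  have pow: "(2::nat) ^ j = 4 * h" "(2::nat) ^ (j - 1) = 2 * h"
  proof -
    obtain i where "j = 2 + i" using j2 le_Suc_ex by blast
    then show "(2::nat) ^ j = 4 * h" "(2::nat) ^ (j - 1) = 2 * h" by (auto simp: h_def)
  qed
  have hN: "4 * h \<le> N" "N < 8 * h"
    using floor_log_exp2_le[of N] floor_log_exp2_gt[of N] N by (auto simp: pow j_def[symmetric])
  have h0: "h > 0" by (simp add: h_def)
  \<comment> \<open>Both pairs sum to \<open>4 * h + i + k + l\<close>, and every entry stays in the
    block because the parameters are below \<open>h\<close>. The third, first and second entries
    recover \<open>i\<close>, \<open>k\<close> and \<open>l\<close>.\<close>
  define F where "F = (\<lambda>(i, k, l). (2 * h + i + k, 2 * h + l, 2 * h + i, 2 * h + k + l))"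
  let ?E = "{(a, b, c, d). a \<in> {1..N} \<and> b \<in> {1..N} \<and> c \<in> {1..N} \<and> d \<in> {1..N}
      \<and> \<bar>x a + x b - x c - x d\<bar> < \<gamma>}"
  let ?T = "{..<h} \<times> {..<h} \<times> {..<h}"
  have level: "floor_log n = j - 1" if "2 * h \<le> n" "n < 4 * h" for n
    using that h0 pow by (intro floor_log_eqI) auto
  have x: "2 * real n \<le> x n \<and> x n \<le> 2 * real n + \<delta> (j - 1)" if "2 * h \<le> n" "n < 4 * h" for n
    using \<delta>[of "j - 1"] v[of n] by (simp add: x_def level[OF that] mult_left_le)
  have sub: "F ` ?T \<subseteq> ?E"
  proof (rule image_subsetI)
    fix t assume "t \<in> ?T"
    then obtain i k l where t: "t = (i, k, l)" and ikl: "i < h" "k < h" "l < h" by auto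
    have "\<bar>x (2 * h + i + k) + x (2 * h + l) - x (2 * h + i) - x (2 * h + k + l)\<bar> \<le> 2 * \<delta> (j - 1)"
      using x[of "2 * h + i + k"] x[of "2 * h + l"] x[of "2 * h + i"] x[of "2 * h + k + l"] ikl
      by (simp add: abs_le_iff)
    then show "F t \<in> ?E" using ikl hN h0 \<gamma> by (simp add: t F_def j_def)
  qed
  have inj: "inj_on F ?T" by (auto simp: inj_on_def F_def)
  have finE: "finite ?E"
    by (rule finite_subset[of _ "{1..N} \<times> {1..N} \<times> {1..N} \<times> {1..N}"]) auto
  have "h ^ 3 = card (F ` ?T)"
    using inj by (simp add: card_image card_cartesian_product power3_eq_cube)
  also have "\<dots> \<le> card ?E" using sub finE by (intro card_mono)
  finally have "h ^ 3 \<le> add_energy x N \<gamma>" by (simp add: add_energy_def)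
  moreover have "real N ^ 3 \<le> (8 * real h) ^ 3" using hN by (intro power_mono) auto
  ultimately have "real N ^ 3 \<le> 512 * real (add_energy x N \<gamma>)"
    by (simp add: power_mult_distrib of_nat_power[symmetric] del: of_nat_power)
  then show ?thesis by (simp add: x_def[abs_def])
qed

section \<open>Pair correlation of the perturbed sequence\<close>

text \<open>Terms below \<open>j0\<close> contribute a fixed amount, negligible against
  \<open>2 ^ J\<close>; the others contribute at most \<open>r / 4 * 2 ^ Suc J\<close>, which is
  \<open>r / 2\<close> after division.\<close>

lemma weighted_sum_tendsto_0:
  fixes K :: "nat \<Rightarrow> real"
  assumes K: "K \<longlonglongrightarrow> 0" and nonneg: "\<And>j. K j \<ge> 0"
  shows "(\<lambda>J. (\<Sum>j\<le>J. K j * 2 ^ j) / 2 ^ J) \<longlonglongrightarrow> 0"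
proof (rule LIMSEQ_I)
  fix r :: real assume r: "r > 0"
  obtain j0 where j0: "\<And>j. j \<ge> j0 \<Longrightarrow> K j < r / 4"
    using order_tendstoD(2)[OF K, of "r / 4"] r by (auto simp: eventually_sequentially)
  define C0 where "C0 = (\<Sum>j<j0. K j * 2 ^ j)"
  have le: "(\<Sum>j\<le>J. K j * 2 ^ j) \<le> C0 + r / 4 * 2 ^ Suc J" for J
  proof -
    have "(\<Sum>j\<le>J. K j * 2 ^ j) \<le> (\<Sum>j\<le>J. (if j < j0 then K j * 2 ^ j else 0) + r / 4 * 2 ^ j)"
    proof (intro sum_mono)
      fix j
      have "K j * 2 ^ j \<le> r / 4 * 2 ^ j" if "\<not> j < j0"
        using j0[of j] that by (intro mult_right_mono) auto
      then show "K j * 2 ^ j \<le> (if j < j0 then K j * 2 ^ j else 0) + r / 4 * 2 ^ j" using r by auto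
    qed
    also have "\<dots> = (\<Sum>j\<le>J. if j < j0 then K j * 2 ^ j else 0) + r / 4 * (\<Sum>j\<le>J. 2 ^ j)"
      by (simp add: sum.distrib sum_distrib_left)
    also have "(\<Sum>j\<le>J. if j < j0 then K j * 2 ^ j else 0) = (\<Sum>j\<in>{..J} \<inter> {..<j0}. K j * 2 ^ j)"
      by (subst sum.inter_restrict) (auto intro: sum.cong)
    also have "\<dots> \<le> C0" unfolding C0_def using nonneg by (intro sum_mono2) auto
    also have "(\<Sum>j\<le>J. 2 ^ j) = (2::real) ^ Suc J - 1"
      by (induction J) auto
    also have "C0 + r / 4 * (2 ^ Suc J - 1) \<le> C0 + r / 4 * 2 ^ Suc J" using r by simp
    finally show ?thesis by simp
  qed
  have "(\<lambda>J. C0 * (1 / 2) ^ J) \<longlonglongrightarrow> C0 * 0"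
    by (intro tendsto_mult tendsto_const LIMSEQ_power_zero) simp
  then have "\<forall>\<^sub>F J in sequentially. C0 * (1 / 2) ^ J < r / 2"
    by (rule order_tendstoD) (use r in simp)
  then obtain J0 where J0: "\<And>J. J \<ge> J0 \<Longrightarrow> C0 * (1 / 2) ^ J < r / 2"
    by (auto simp: eventually_sequentially)
  show "\<exists>no. \<forall>n\<ge>no. norm ((\<Sum>j\<le>n. K j * 2 ^ j) / 2 ^ n - 0) < r"
  proof (intro exI allI impI)
    fix J assume "J \<ge> J0"
    have "(\<Sum>j\<le>J. K j * 2 ^ j) / 2 ^ J \<le> (C0 + r / 4 * 2 ^ Suc J) / 2 ^ J"
      by (intro divide_right_mono le) simp
    also have "\<dots> = C0 * (1 / 2) ^ J + r / 2" by (simp add: add_divide_distrib power_one_over)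
    also have "\<dots> < r" using J0[OF \<open>J \<ge> J0\<close>] by simp
    finally show "norm ((\<Sum>j\<le>J. K j * 2 ^ j) / 2 ^ J - 0) < r"
      using nonneg by (simp add: sum_nonneg abs_of_nonneg)
  qed
qed

lemma filterlim_floor_log: "filterlim floor_log at_top sequentially"
  unfolding filterlim_at_top
proof
  fix Z :: nat
  show "\<forall>\<^sub>F N in sequentially. Z \<le> floor_log N"
    using eventually_ge_at_top[of "2 ^ Z"]
    by eventually_elim (use floor_log_le_iff[of "2 ^ Z"] in simp)
qed

text \<open>The amplitude is constant on dyadic blocks, where the partners run through a progression
  of step \<open>- 2 * \<alpha>\<close>, so \<open>hit_prob_block\<close> applies block by block.
  The block errors add up to a dyadically weighted sum, uniformly in \<open>z\<close> and
  \<open>m\<close>.\<close>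

lemma hit_prob_sum:
  fixes \<delta> :: "nat \<Rightarrow> real" and \<alpha> s :: real
  assumes \<delta>: "\<And>j. \<delta> j > 0" and L: "(\<lambda>j. 1 / (2 ^ j * \<delta> j)) \<longlonglongrightarrow> 0"
    and \<alpha>: "\<alpha> > 0" "good_multiplier \<delta> \<alpha>" and s: "s > 0"
  shows "\<exists>e. e \<longlonglongrightarrow> 0 \<and> (\<forall>\<^sub>F N in sequentially. \<forall>z. \<forall>m\<in>{1..Suc N}.
    \<bar>(\<Sum>n\<in>{1..<m}. hit_prob (\<alpha> * \<delta> (floor_log n)) (s / real N) (z - 2 * \<alpha> * real n))
      - 2 * (s / real N) * (real m - 1)\<bar> \<le> e N)"
proof -
  obtain q h where qh: "\<And>j. q j > 0" "\<And>j. coprime (h j) (int (q j))"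
    "\<And>j. \<bar>real (q j) * (- 2 * \<alpha>) - of_int (h j)\<bar> \<le> 1 / real (q j)"
    and q1: "(\<lambda>j. 1 / (real (q j) * \<delta> j)) \<longlonglongrightarrow> 0" and q2: "(\<lambda>j. real (q j) / 2 ^ j) \<longlonglongrightarrow> 0"
    using \<alpha>(2) unfolding good_multiplier_def by blast
  \<comment> \<open>The error of \<open>hit_prob_block\<close> on a block of length at most
    \<open>2 ^ j\<close> with \<open>\<sigma> \<le> s / 2 ^ j\<close>, divided by
    \<open>\<sigma> * 2 ^ j\<close>. It tends to 0 by \<open>L\<close>, \<open>q1\<close> and
    \<open>q2\<close>.\<close>
  define K where "K j = (2 * (2 * s + 3) / \<alpha>) * (1 / (2 ^ j * \<delta> j)) + 6 / \<alpha> * (1 / (real (q j) * \<delta> j))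
    + 2 * (real (q j) / 2 ^ j) * (1 + 2 * s / \<alpha> * (1 / (2 ^ j * \<delta> j)))" for j
  have K_lim: "K \<longlonglongrightarrow> 0"
  proof -
    have "K \<longlonglongrightarrow> (2 * (2 * s + 3) / \<alpha>) * 0 + 6 / \<alpha> * 0 + 2 * 0 * (1 + 2 * s / \<alpha> * 0)"
      unfolding K_def[abs_def] by (intro tendsto_intros L q1 q2)
    then show ?thesis by simp
  qed
  have K_nonneg: "K j \<ge> 0" for j
    unfolding K_def using \<alpha> s \<delta>[of j] by (intro add_nonneg_nonneg mult_nonneg_nonneg) auto
  define hp where "hp \<sigma> z n = hit_prob (\<alpha> * \<delta> (floor_log n)) \<sigma> (z - 2 * \<alpha> * real n)" for \<sigma> z n
  \<comment> \<open>The identity behind the choice of \<open>K\<close>, with \<open>x\<close>,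
    \<open>a\<close>, \<open>d\<close>, \<open>p\<close>, \<open>B\<close> standing for
    \<open>\<sigma>\<close>, \<open>\<alpha>\<close>, \<open>\<delta> j\<close>, \<open>q j\<close>,
    \<open>2 ^ j\<close>.\<close>
  have ident: "2 * x / (a * d) * (2 * s + 3 * B / p + p * (a * d + 2 * (s / B)) + 3)
    = x * ((2 * (2 * s + 3) / a * (1 / (B * d)) + 6 / a * (1 / (p * d)) + 2 * (p / B) * (1 + 2 * s / a * (1 / (B * d)))) * B)"
    if "a > 0" "d > 0" "p > 0" "B > 0" for a d p B x :: real
    using that by (simp add: divide_simps) (simp add: algebra_simps)
  have block: "\<bar>(\<Sum>n\<in>{2 ^ j..<2 ^ j + M}. hp \<sigma> z n) - 2 * \<sigma> * real M\<bar> \<le> \<sigma> * (K j * 2 ^ j)"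
    if \<sigma>: "0 < \<sigma>" "\<sigma> \<le> 1 / 2" "\<sigma> \<le> s / 2 ^ j" and M: "M \<le> 2 ^ j" for \<sigma> z j M
  proof -
    let ?l = "\<alpha> * \<delta> j" and ?B = "2 ^ j :: real"
    have l: "?l > 0" using \<alpha> \<delta> by simp
    have q: "real (q j) > 0" using qh(1) by simp
    have MB: "real M \<le> ?B" using M by (metis of_nat_le_iff of_nat_numeral of_nat_power)
    have "(\<Sum>n\<in>{2 ^ j..<2 ^ j + M}. hp \<sigma> z n)
        = (\<Sum>r<M. hit_prob ?l \<sigma> ((z - 2 * \<alpha> * 2 ^ j) + real r * (- 2 * \<alpha>)))"
    proof (rule sum.reindex_bij_witness[of _ "\<lambda>r. 2 ^ j + r" "\<lambda>n. n - 2 ^ j"])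
      fix n assume n: "n \<in> {2 ^ j..<2 ^ j + M}"
      have "floor_log n = j"
        using n M zero_less_power[of "2::nat" j] by (intro floor_log_eqI) (auto simp del: zero_less_power)
      then show "hit_prob ?l \<sigma> ((z - 2 * \<alpha> * 2 ^ j) + real (n - 2 ^ j) * (- 2 * \<alpha>)) = hp \<sigma> z n"
        using n by (simp add: hp_def of_nat_diff algebra_simps)
    qed auto
    then have "\<bar>(\<Sum>n\<in>{2 ^ j..<2 ^ j + M}. hp \<sigma> z n) - 2 * \<sigma> * real M\<bar>
        \<le> 2 * \<sigma> / ?l * (2 * \<sigma> * real M + 3 * real M / real (q j) + real (q j) * (?l + 2 * \<sigma>) + 3)"
      using hit_prob_block[OF qh(1) qh(2) qh(3) l \<sigma>(1,2)] by simp
    also have "\<dots> \<le> 2 * \<sigma> / ?l * (2 * s + 3 * ?B / real (q j) + real (q j) * (?l + 2 * (s / ?B)) + 3)"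
    proof (intro mult_left_mono add_mono order_refl)
      have "\<sigma> * real M \<le> s / ?B * ?B" using \<sigma> s MB by (intro mult_mono) auto
      then show "2 * \<sigma> * real M \<le> 2 * s" by simp
      show "3 * real M / real (q j) \<le> 3 * ?B / real (q j)" using MB by (intro divide_right_mono) auto
    qed (use l \<sigma> \<alpha>(1) in auto)
    also have "\<dots> = \<sigma> * (K j * 2 ^ j)"
      unfolding K_def using \<alpha>(1) \<delta>[of j] q by (intro ident) auto
    finally show ?thesis .
  qed
  have full: "\<bar>(\<Sum>n\<in>{1..<2 ^ J}. hp \<sigma> z n) - 2 * \<sigma> * (2 ^ J - 1)\<bar> \<le> \<sigma> * (\<Sum>j<J. K j * 2 ^ j)"
    if \<sigma>: "0 < \<sigma>" "\<sigma> \<le> 1 / 2" "\<sigma> \<le> s / 2 ^ J" for \<sigma> z J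
    using \<sigma>(3)
  proof (induction J)
    case (Suc J)
    have "s / 2 ^ Suc J \<le> s / 2 ^ J" using s by (intro divide_left_mono) auto
    with Suc.prems have \<sigma>J: "\<sigma> \<le> s / 2 ^ J" by linarith
    have "(\<Sum>n\<in>{1..<2 ^ Suc J}. hp \<sigma> z n) = (\<Sum>n\<in>{1..<2 ^ J}. hp \<sigma> z n) + (\<Sum>n\<in>{2 ^ J..<2 ^ J + 2 ^ J}. hp \<sigma> z n)"
      by (subst sum.atLeastLessThan_concat) (auto simp: mult_2)
    moreover have "\<bar>(\<Sum>n\<in>{2 ^ J..<2 ^ J + 2 ^ J}. hp \<sigma> z n) - 2 * \<sigma> * 2 ^ J\<bar> \<le> \<sigma> * (K J * 2 ^ J)"
      using block[OF \<sigma>(1,2) \<sigma>J, of "2 ^ J"] by simp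
    moreover have "2 * \<sigma> * (2 ^ Suc J - 1) = 2 * \<sigma> * (2 ^ J - 1) + 2 * \<sigma> * 2 ^ J"
      by (simp add: algebra_simps)
    moreover have "\<sigma> * (\<Sum>j<Suc J. K j * 2 ^ j) = \<sigma> * (\<Sum>j<J. K j * 2 ^ j) + \<sigma> * (K J * 2 ^ J)"
      by (simp add: algebra_simps)
    ultimately show ?case using Suc.IH[OF \<sigma>J] by linarith
  qed simp
  \<comment> \<open>Complete blocks below \<open>2 ^ J\<close>, followed by an initial segment of
    block \<open>J\<close>, which is the whole block when \<open>m = 2 * 2 ^ J\<close>.\<close>
  have partial: "\<bar>(\<Sum>n\<in>{1..<m}. hp \<sigma> z n) - 2 * \<sigma> * (real m - 1)\<bar> \<le> \<sigma> * (\<Sum>j\<le>J. K j * 2 ^ j)"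
    if \<sigma>: "0 < \<sigma>" "\<sigma> \<le> 1 / 2" "\<sigma> \<le> s / 2 ^ J" and m: "2 ^ J \<le> m" "m \<le> 2 * 2 ^ J" for \<sigma> z J m
  proof -
    define M where "M = m - 2 ^ J"
    have M: "m = 2 ^ J + M" "M \<le> 2 ^ J" using m by (auto simp: M_def)
    have "(\<Sum>n\<in>{1..<m}. hp \<sigma> z n) = (\<Sum>n\<in>{1..<2 ^ J}. hp \<sigma> z n) + (\<Sum>n\<in>{2 ^ J..<2 ^ J + M}. hp \<sigma> z n)"
      unfolding M(1) by (subst sum.atLeastLessThan_concat) auto
    moreover have "2 * \<sigma> * (real m - 1) = 2 * \<sigma> * (2 ^ J - 1) + 2 * \<sigma> * real M"
      by (simp add: M(1) algebra_simps)
    moreover have "\<sigma> * (\<Sum>j\<le>J. K j * 2 ^ j) = \<sigma> * (\<Sum>j<J. K j * 2 ^ j) + \<sigma> * (K J * 2 ^ J)"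
      by (simp add: lessThan_Suc_atMost[symmetric] algebra_simps)
    ultimately show ?thesis using full[OF \<sigma>, of z] block[OF \<sigma> M(2), of z] by linarith
  qed
  define e where "e N = s * ((\<Sum>j\<le>floor_log N. K j * 2 ^ j) / 2 ^ floor_log N)" for N
  have "e \<longlonglongrightarrow> s * 0"
    unfolding e_def[abs_def]
    by (intro tendsto_mult tendsto_const
        filterlim_compose[OF weighted_sum_tendsto_0[OF K_lim K_nonneg] filterlim_floor_log])
  moreover have "\<forall>\<^sub>F N in sequentially. \<forall>z. \<forall>m\<in>{1..Suc N}.
    \<bar>(\<Sum>n\<in>{1..<m}. hp (s / real N) z n) - 2 * (s / real N) * (real m - 1)\<bar> \<le> e N"
  proof -
    have ev: "\<forall>\<^sub>F N in sequentially. real N \<ge> 2 * s"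
      using filterlim_real_sequentially by (simp add: filterlim_at_top)
    show ?thesis
      using ev eventually_gt_at_top[of 0]
    proof (eventually_elim, intro allI ballI)
      fix N z and m :: nat
      assume N: "2 * s \<le> real N" "0 < N" and m: "m \<in> {1..Suc N}"
      define \<sigma> where "\<sigma> = s / real N"
      define J where "J = floor_log N"
      \<comment> \<open>For \<open>m = N + 1\<close> the logarithm may already jump to
        \<open>J + 1\<close>; taking \<open>J\<close> instead keeps the block index at most
        \<open>J\<close>.\<close>
      define J' where "J' = (if m \<le> N then floor_log m else J)"
      have N2: "2 ^ J \<le> real N"
        using floor_log_exp2_le[of N] N by (metis J_def of_nat_le_iff of_nat_numeral of_nat_power)
      have JJ: "J' \<le> J" using m by (auto simp: J'_def J_def intro: floor_log_le_iff)
      have bd: "2 ^ J' \<le> m" "m \<le> 2 * 2 ^ J'"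
        using m N(2) floor_log_exp2_le[of m] floor_log_exp2_gt[of m] floor_log_exp2_le[of N] floor_log_exp2_gt[of N]
        by (auto simp: J'_def J_def split: if_splits)
      have \<sigma>: "0 < \<sigma>" "\<sigma> \<le> 1 / 2" using N s by (auto simp: \<sigma>_def field_simps)
      have \<sigma>J: "\<sigma> \<le> s / 2 ^ J" unfolding \<sigma>_def using s N N2 by (intro divide_left_mono) auto
      also have "\<dots> \<le> s / 2 ^ J'" using s JJ by (intro divide_left_mono power_increasing) auto
      finally have "\<bar>(\<Sum>n\<in>{1..<m}. hp \<sigma> z n) - 2 * \<sigma> * (real m - 1)\<bar> \<le> \<sigma> * (\<Sum>j\<le>J'. K j * 2 ^ j)"
        using \<sigma> bd by (intro partial)
      also have "\<dots> \<le> \<sigma> * (\<Sum>j\<le>J. K j * 2 ^ j)"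
        using \<sigma> JJ K_nonneg by (intro mult_left_mono sum_mono2) auto
      also have "\<dots> \<le> s / 2 ^ J * (\<Sum>j\<le>J. K j * 2 ^ j)"
        using \<sigma>J K_nonneg by (intro mult_right_mono sum_nonneg) auto
      also have "\<dots> = e N" by (simp add: e_def J_def)
      finally show "\<bar>(\<Sum>n\<in>{1..<m}. hp (s / real N) z n) - 2 * (s / real N) * (real m - 1)\<bar> \<le> e N"
        by (simp add: \<sigma>_def)
    qed
  qed
  ultimately show ?thesis unfolding hp_def by (intro exI[of _ e] conjI) simp_all
qed

text \<open>By monotone convergence the series of the \<open>(F k x)\<^sup>2\<close> is finite
  almost everywhere, so its terms tend to 0.\<close>

lemma AE_tendsto_0_of_summable_second_moments:
  fixes F :: "nat \<Rightarrow> 'a \<Rightarrow> real"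
  assumes [measurable]: "\<And>k. F k \<in> borel_measurable M" and int: "\<And>k. integrable M (\<lambda>x. (F k x)\<^sup>2)"
    and le: "\<And>k. (\<integral>x. (F k x)\<^sup>2 \<partial>M) \<le> a k" and a: "summable a"
  shows "AE x in M. (\<lambda>k. F k x) \<longlonglongrightarrow> 0"
proof -
  have a0: "0 \<le> a k" for k
    by (rule order_trans[OF _ le[of k]]) simp
  have "(\<integral>\<^sup>+x. (\<Sum>k. ennreal ((F k x)\<^sup>2)) \<partial>M) = (\<Sum>k. \<integral>\<^sup>+x. ennreal ((F k x)\<^sup>2) \<partial>M)"
    by (rule nn_integral_suminf) measurable
  also have "\<dots> = (\<Sum>k. ennreal (\<integral>x. (F k x)\<^sup>2 \<partial>M))"
    by (intro suminf_cong nn_integral_eq_integral int) auto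
  also have "\<dots> \<le> (\<Sum>k. ennreal (a k))"
    by (intro suminf_le ennreal_leI le summableI)
  also have "\<dots> < \<infinity>"
    using ennreal_suminf_neq_top[OF a a0] by (simp add: less_top)
  finally have "AE x in M. (\<Sum>k. ennreal ((F k x)\<^sup>2)) \<noteq> \<infinity>"
    by (intro nn_integral_PInf_AE) auto
  then show ?thesis
  proof (rule AE_mp, intro AE_I2 impI)
    fix x assume "(\<Sum>k. ennreal ((F k x)\<^sup>2)) \<noteq> \<infinity>"
    then have "summable (\<lambda>k. (F k x)\<^sup>2)"
      by (intro summable_suminf_not_top) auto
    then have "(\<lambda>k. (F k x)\<^sup>2) \<longlonglongrightarrow> 0" by (rule summable_LIMSEQ_zero)
    then have "(\<lambda>k. sqrt ((F k x)\<^sup>2)) \<longlonglongrightarrow> sqrt 0" by (intro tendsto_real_sqrt)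
    then show "(\<lambda>k. F k x) \<longlonglongrightarrow> 0" by (simp add: tendsto_rabs_zero_iff)
  qed
qed

section \<open>Pair counts as triangular sums of indicator kernels\<close>

lemma sum_triangle_swap:
  fixes f :: "nat \<Rightarrow> nat \<Rightarrow> real"
  shows "(\<Sum>n\<in>{1..N}. \<Sum>m\<in>{n<..N}. f m n) = (\<Sum>m\<in>{1..N}. \<Sum>n\<in>{1..<m}. f m n)"
proof -
  have "(\<Sum>n\<in>{1..N}. \<Sum>m\<in>{n<..N}. f m n) = (\<Sum>n\<in>{1..N}. \<Sum>m | m \<in> {1..N} \<and> n < m. f m n)"
    by (intro sum.cong refl) auto
  also have "\<dots> = (\<Sum>m\<in>{1..N}. \<Sum>n | n \<in> {1..N} \<and> n < m. f m n)"
    by (rule sum.swap_restrict) auto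
  also have "\<dots> = (\<Sum>m\<in>{1..N}. \<Sum>n\<in>{1..<m}. f m n)"
    by (intro sum.cong refl) auto
  finally show ?thesis .
qed

lemma pair_count_eq_sum:
  "real (pair_count y N s) = (\<Sum>n\<in>{1..N}. \<Sum>m\<in>{1..N}. of_bool (m \<noteq> n \<and> dist_int (y m - y n) < s / real N))"
proof -
  let ?S = "{(m, n). m \<in> {1..N} \<and> n \<in> {1..N} \<and> m \<noteq> n \<and> dist_int (y m - y n) < s / real N}"
  have "real (pair_count y N s) = (\<Sum>p\<in>?S. 1)" by (simp add: pair_count_def)
  also have "\<dots> = (\<Sum>p\<in>{1..N} \<times> {1..N}. of_bool (p \<in> ?S))"
    by (rule sum.mono_neutral_cong_left) auto
  also have "\<dots> = (\<Sum>m\<in>{1..N}. \<Sum>n\<in>{1..N}. of_bool ((m, n) \<in> ?S))"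
    unfolding sum.cartesian_product by (intro sum.cong refl) auto
  also have "\<dots> = (\<Sum>n\<in>{1..N}. \<Sum>m\<in>{1..N}. of_bool ((m, n) \<in> ?S))"
    by (rule sum.swap)
  also have "\<dots> = (\<Sum>n\<in>{1..N}. \<Sum>m\<in>{1..N}. of_bool (m \<noteq> n \<and> dist_int (y m - y n) < s / real N))"
    by (intro sum.cong refl) auto
  finally show ?thesis .
qed

lemma pair_count_eq_triangle:
  "real (pair_count y N s) = 2 * (\<Sum>n\<in>{1..N}. \<Sum>m\<in>{n<..N}. of_bool (dist_int (y m - y n) < s / real N))"
proof -
  let ?h = "\<lambda>m n. of_bool (dist_int (y m - y n) < s / real N) :: real"
  have sym: "?h m n = ?h n m" for m n
    using dist_int_minus_less_iff[of "y m - y n"] by simp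
  have "real (pair_count y N s) = (\<Sum>n\<in>{1..N}. (\<Sum>m\<in>{n<..N}. ?h m n) + (\<Sum>m\<in>{1..<n}. ?h m n))"
    unfolding pair_count_eq_sum
  proof (rule sum.cong[OF refl])
    fix n assume n: "n \<in> {1..N}"
    have "{1..N} = insert n ({n<..N} \<union> {1..<n})" using n by auto
    then have "(\<Sum>m\<in>{1..N}. of_bool (m \<noteq> n \<and> dist_int (y m - y n) < s / real N))
      = (\<Sum>m\<in>{n<..N} \<union> {1..<n}. of_bool (m \<noteq> n \<and> dist_int (y m - y n) < s / real N) :: real)"
      by simp
    also have "\<dots> = (\<Sum>m\<in>{n<..N} \<union> {1..<n}. ?h m n)" by (intro sum.cong refl) auto
    also have "\<dots> = (\<Sum>m\<in>{n<..N}. ?h m n) + (\<Sum>m\<in>{1..<n}. ?h m n)"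
      by (intro sum.union_disjoint) auto
    finally show "(\<Sum>m\<in>{1..N}. of_bool (m \<noteq> n \<and> dist_int (y m - y n) < s / real N))
      = (\<Sum>m\<in>{n<..N}. ?h m n) + (\<Sum>m\<in>{1..<n}. ?h m n)" .
  qed
  also have "\<dots> = (\<Sum>n\<in>{1..N}. \<Sum>m\<in>{n<..N}. ?h m n) + (\<Sum>n\<in>{1..N}. \<Sum>m\<in>{1..<n}. ?h n m)"
    by (subst sym) (simp add: sum.distrib)
  also have "(\<Sum>n\<in>{1..N}. \<Sum>m\<in>{1..<n}. ?h n m) = (\<Sum>n\<in>{1..N}. \<Sum>m\<in>{n<..N}. ?h m n)"
    by (rule sum_triangle_swap[symmetric])
  finally show ?thesis by simp
qed

text \<open>The clipping to the unit interval is inactive almost surely; it makes the gap condition hold for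
  every sample.\<close>

definition clip :: "real \<Rightarrow> real" where
  "clip y = max 0 (min 1 y)"

text \<open>Spacing 2 leaves gaps of at least 1 as long as the amplitudes are at most 1. The
  amplitude depends only on the dyadic block, which keeps each block a perturbed arithmetic
  progression.\<close>

definition perturbed :: "(nat \<Rightarrow> real) \<Rightarrow> (nat \<Rightarrow> real) \<Rightarrow> nat \<Rightarrow> real" where
  "perturbed \<delta> u n = 2 * real n + \<delta> (floor_log n) * clip (u n)"

abbreviation unif :: "real measure" where
  "unif \<equiv> uniform_measure lborel {0..1}"

interpretation unif: iid_sequence unif
  by (intro iid_sequence.intro prob_space_uniform_measure) auto

lemma borel_measurable_clip [measurable]: "clip \<in> borel_measurable borel"
  unfolding clip_def[abs_def] by measurable

text \<open>On \<open>[0, 1]\<close>, where \<open>unif\<close> is concentrated, \<open>clip\<close>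
  is the identity; this links averaged kernels to \<open>hit_prob\<close>.\<close>

lemma integral_unif_hit:
  "(\<integral>y. of_bool (dist_int (z - \<alpha> * (2 * real n + d * clip y)) < \<sigma>) \<partial>unif)
    = hit_prob (\<alpha> * d) \<sigma> (z - 2 * \<alpha> * real n)"
proof -
  let ?S = "{y. dist_int (z - \<alpha> * (2 * real n + d * clip y)) < \<sigma>}"
  have S [measurable]: "?S \<in> sets borel" by measurable
  have "(\<integral>y. of_bool (dist_int (z - \<alpha> * (2 * real n + d * clip y)) < \<sigma>) \<partial>unif) = (\<integral>y. indicator ?S y \<partial>unif)"
    by (intro Bochner_Integration.integral_cong) (auto simp: indicator_def)
  also have "\<dots> = measure unif ?S" by simp
  also have "\<dots> = measure lborel ({0..1} \<inter> ?S)"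
    by (subst measure_uniform_measure) auto
  also have "{0..1} \<inter> ?S = {y \<in> {0..1}. dist_int (z - 2 * \<alpha> * real n - \<alpha> * d * y) < \<sigma>}"
    by (auto simp: clip_def algebra_simps)
  finally show ?thesis by (simp add: hit_prob_def)
qed

text \<open>Half the count is \<open>T\<close>, the sum of the means over the smaller-indexed
  variable, plus a fluctuation \<open>D\<close>. Equidistribution makes \<open>T / N\<close> tend to
  \<open>s\<close>; the second moment of \<open>D / N\<close> is \<open>O(1 / N)\<close>, which is
  summable along squares.\<close>

lemma AE_pair_count_squares:
  fixes \<delta> :: "nat \<Rightarrow> real" and \<alpha> s :: real
  assumes \<delta>: "\<And>j. \<delta> j > 0" and L: "(\<lambda>j. 1 / (2 ^ j * \<delta> j)) \<longlonglongrightarrow> 0"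
    and \<alpha>: "\<alpha> > 0" "good_multiplier \<delta> \<alpha>" and s: "s > 0"
  shows "AE u in unif.iid. (\<lambda>k. real (pair_count (\<lambda>n. \<alpha> * perturbed \<delta> u n) (k\<^sup>2) s) / real (k\<^sup>2)) \<longlonglongrightarrow> 2 * s"
proof -
  define X where "X n y = \<alpha> * (2 * real n + \<delta> (floor_log n) * clip y)" for n y
  define A where "A N m n x y = (of_bool (dist_int (X m x - X n y) < s / real N) :: real)" for N m n :: nat and x y
  define hp where "hp N n z = hit_prob (\<alpha> * \<delta> (floor_log n)) (s / real N) (z - 2 * \<alpha> * real n)" for N n z
  have X_meas [measurable]: "X n \<in> borel_measurable borel" for n unfolding X_def[abs_def] by measurable
  have int_y: "(\<integral>y. A N m n x y \<partial>unif) = hp N n (X m x)" for N m n x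
    unfolding A_def hp_def X_def[of n] by (rule integral_unif_hit)
  have A_sym: "A N m n x y = A N n m y x" for N m n x y
    using dist_int_minus_less_iff[of "X m x - X n y"] by (simp add: A_def)
  have int_x: "(\<integral>x. A N m n x y \<partial>unif) = hp N m (X n y)" for N m n y
    by (subst A_sym) (rule int_y)
  obtain e where e: "e \<longlonglongrightarrow> 0" and ev: "\<forall>\<^sub>F N in sequentially. \<forall>z. \<forall>m\<in>{1..Suc N}.
    \<bar>(\<Sum>n\<in>{1..<m}. hp N n z) - 2 * (s / real N) * (real m - 1)\<bar> \<le> e N"
    unfolding hp_def using hit_prob_sum[OF assms] by blast
  have "\<forall>\<^sub>F N in sequentially. e N < 1" by (rule order_tendstoD[OF e]) simp
  with ev eventually_gt_at_top[of 0] have "\<forall>\<^sub>F N in sequentially. N > 0 \<and> e N < 1 \<and> (\<forall>z. \<forall>m\<in>{1..Suc N}.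
    \<bar>(\<Sum>n\<in>{1..<m}. hp N n z) - 2 * (s / real N) * (real m - 1)\<bar> \<le> e N)"
    by eventually_elim auto
  then obtain N0 where N0: "\<And>N. N \<ge> N0 \<Longrightarrow> N > 0" "\<And>N. N \<ge> N0 \<Longrightarrow> e N < 1"
    "\<And>N z m. N \<ge> N0 \<Longrightarrow> m \<in> {1..Suc N} \<Longrightarrow>
      \<bar>(\<Sum>n\<in>{1..<m}. hp N n z) - 2 * (s / real N) * (real m - 1)\<bar> \<le> e N"
    unfolding eventually_sequentially by blast
  have N0pos: "N0 > 0" using N0(1)[of N0] by simp
  define C where "C = 2 * s + 1"
  \<comment> \<open>The kernel is symmetric, so averaging over the larger index again gives hit
    probabilities. The sum is enlarged to all \<open>m \<le> N\<close>, which is why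
    \<open>hit_prob_sum\<close> admits the upper end \<open>Suc N\<close>.\<close>
  have col: "(\<Sum>m\<in>{n<..N}. \<integral>x. A N m n x y \<partial>unif) \<le> C" if "N \<ge> N0" for N n y
  proof -
    have "(\<Sum>m\<in>{n<..N}. \<integral>x. A N m n x y \<partial>unif) = (\<Sum>m\<in>{n<..N}. hp N m (X n y))"
      by (simp add: int_x)
    also have "\<dots> \<le> (\<Sum>m\<in>{1..<Suc N}. hp N m (X n y))"
      by (intro sum_mono2) (auto simp: hp_def hit_prob_nonneg)
    also have "\<dots> \<le> 2 * (s / real N) * (real (Suc N) - 1) + e N"
      using N0(3)[OF that, of "Suc N" "X n y"] by auto
    also have "\<dots> \<le> C" using N0(1,2)[OF that] by (simp add: C_def)
    finally show ?thesis .
  qed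
  define D where "D N u = (\<Sum>n\<in>{1..N}. \<Sum>m\<in>{n<..N}. A N m n (u m) (u n) - (\<integral>y. A N m n (u m) y \<partial>unif))"
    for N and u :: "nat \<Rightarrow> real"
  have A_meas: "(\<lambda>(x, y). A N m n x y) \<in> borel_measurable (unif \<Otimes>\<^sub>M unif)" for N m n
  proof -
    have [measurable_cong]: "sets unif = sets borel" by simp
    show ?thesis unfolding A_def by measurable
  qed
  have D2: "D N \<in> borel_measurable unif.iid" "\<exists>B. \<forall>u. \<bar>D N u\<bar> \<le> B"
    "(\<integral>u. (D N u)\<^sup>2 \<partial>unif.iid) \<le> real N * (C\<^sup>2 + C)" if "N \<ge> N0" for N
  proof -
    have A01: "0 \<le> A N m n x y" "A N m n x y \<le> 1" for m n x y by (auto simp: A_def)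
    note sm = unif.second_moment_pair_sum[where A = "A N" and N = N and C = C, OF A_meas A01 col[OF that]]
    show "D N \<in> borel_measurable unif.iid" "\<exists>B. \<forall>u. \<bar>D N u\<bar> \<le> B"
      "(\<integral>u. (D N u)\<^sup>2 \<partial>unif.iid) \<le> real N * (C\<^sup>2 + C)"
      using sm unfolding D_def[abs_def] by blast+
  qed
  \<comment> \<open>Shifting by \<open>N0\<close> puts every square in the range where the bounds
    hold; \<open>LIMSEQ_offset\<close> undoes the shift at the end.\<close>
  define k1 where "k1 k = k + N0" for k
  have k1: "(k1 k)\<^sup>2 \<ge> N0" "k1 k > 0" for k
  proof -
    have "N0 * 1 \<le> k1 k * k1 k" unfolding k1_def using N0pos by (intro mult_mono) auto
    then show "(k1 k)\<^sup>2 \<ge> N0" "k1 k > 0" using N0pos by (auto simp: power2_eq_square k1_def)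
  qed
  have "AE u in unif.iid. (\<lambda>k. D ((k1 k)\<^sup>2) u / real ((k1 k)\<^sup>2)) \<longlonglongrightarrow> 0"
  proof (rule AE_tendsto_0_of_summable_second_moments)
    fix k
    note d = D2[OF k1(1)[of k]]
    note [measurable] = d(1)
    show "(\<lambda>u. D ((k1 k)\<^sup>2) u / real ((k1 k)\<^sup>2)) \<in> borel_measurable unif.iid" by measurable
    obtain B where B: "\<And>u. \<bar>D ((k1 k)\<^sup>2) u\<bar> \<le> B" using d(2) by blast
    have i: "integrable unif.iid (\<lambda>u. (D ((k1 k)\<^sup>2) u)\<^sup>2)"
    proof (rule unif.integrable_bounded[where B = "B\<^sup>2"])
      show "\<bar>(D ((k1 k)\<^sup>2) u)\<^sup>2\<bar> \<le> B\<^sup>2" for u using power_mono[OF B[of u], of 2] by simp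
    qed measurable
    then show "integrable unif.iid (\<lambda>u. (D ((k1 k)\<^sup>2) u / real ((k1 k)\<^sup>2))\<^sup>2)"
      by (simp add: power_divide)
    have "(\<integral>u. (D ((k1 k)\<^sup>2) u / real ((k1 k)\<^sup>2))\<^sup>2 \<partial>unif.iid)
        = (\<integral>u. (D ((k1 k)\<^sup>2) u)\<^sup>2 \<partial>unif.iid) / (real ((k1 k)\<^sup>2))\<^sup>2"
      by (simp add: power_divide)
    also have "\<dots> \<le> real ((k1 k)\<^sup>2) * (C\<^sup>2 + C) / (real ((k1 k)\<^sup>2))\<^sup>2"
      by (intro divide_right_mono d(3)) simp
    also have "\<dots> = (C\<^sup>2 + C) * (1 / real (k1 k) ^ 2)"
      using k1(2)[of k] by (simp add: power2_eq_square)
    finally show "(\<integral>u. (D ((k1 k)\<^sup>2) u / real ((k1 k)\<^sup>2))\<^sup>2 \<partial>unif.iid) \<le> (C\<^sup>2 + C) * (1 / real (k1 k) ^ 2)" .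
  next
    have "summable (\<lambda>k. 1 / real k ^ 2)"
      using inverse_power_summable[of 2, where 'a = real] by (simp add: inverse_eq_divide)
    then have "summable (\<lambda>k. 1 / real (k1 k) ^ 2)"
      unfolding k1_def by (rule summable_ignore_initial_segment)
    then show "summable (\<lambda>k. (C\<^sup>2 + C) * (1 / real (k1 k) ^ 2))" by (rule summable_mult)
  qed
  then show ?thesis
  proof (rule AE_mp, intro AE_I2 impI)
    fix u assume D0: "(\<lambda>k. D ((k1 k)\<^sup>2) u / real ((k1 k)\<^sup>2)) \<longlonglongrightarrow> 0"
    define T where "T N = (\<Sum>m\<in>{1..N}. \<Sum>n\<in>{1..<m}. hp N n (X m (u m)))" for N
    have count: "real (pair_count (\<lambda>n. \<alpha> * perturbed \<delta> u n) N s) = 2 * (D N u + T N)" for N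
    proof -
      have "real (pair_count (\<lambda>n. \<alpha> * perturbed \<delta> u n) N s) = 2 * (\<Sum>n\<in>{1..N}. \<Sum>m\<in>{n<..N}. A N m n (u m) (u n))"
        unfolding pair_count_eq_triangle by (simp add: A_def X_def perturbed_def)
      also have "(\<Sum>n\<in>{1..N}. \<Sum>m\<in>{n<..N}. A N m n (u m) (u n))
          = D N u + (\<Sum>n\<in>{1..N}. \<Sum>m\<in>{n<..N}. hp N n (X m (u m)))"
        unfolding D_def int_y by (simp add: sum_subtractf)
      also have "(\<Sum>n\<in>{1..N}. \<Sum>m\<in>{n<..N}. hp N n (X m (u m))) = T N"
        unfolding T_def by (rule sum_triangle_swap)
      finally show ?thesis .
    qed
    \<comment> \<open>The main terms \<open>2 * (s / N) * (m - 1)\<close> sum to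
      \<open>s * (N - 1)\<close>, and each of the \<open>N\<close> rows errs by at most
      \<open>e N\<close>.\<close>
    have T: "\<bar>T N - s * (real N - 1)\<bar> \<le> real N * e N" if "N \<ge> N0" for N
    proof -
      have gauss: "(\<Sum>m\<in>{1..N}. real m - 1) = real N * (real N - 1) / 2"
        by (induction N) (auto simp: field_simps)
      have "(\<Sum>m\<in>{1..N}. 2 * (s / real N) * (real m - 1)) = s * (real N - 1)"
        unfolding sum_distrib_left[symmetric] gauss using N0(1)[OF that] by simp
      then have "\<bar>T N - s * (real N - 1)\<bar>
          = \<bar>\<Sum>m\<in>{1..N}. (\<Sum>n\<in>{1..<m}. hp N n (X m (u m))) - 2 * (s / real N) * (real m - 1)\<bar>"
        by (simp add: T_def sum_subtractf)
      also have "\<dots> \<le> (\<Sum>m\<in>{1..N}. e N)"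
        by (rule order_trans[OF sum_abs]) (intro sum_mono N0(3)[OF that], auto)
      finally show ?thesis by simp
    qed
    have "(\<lambda>N. T N / real N - s) \<longlonglongrightarrow> 0"
    proof (rule Lim_null_comparison)
      have "(\<lambda>N. s / real N) \<longlonglongrightarrow> 0" by real_asymp
      from tendsto_add[OF e this] show "(\<lambda>N. e N + s / real N) \<longlonglongrightarrow> 0" by simp
      show "\<forall>\<^sub>F N in sequentially. norm (T N / real N - s) \<le> e N + s / real N"
        using eventually_ge_at_top[of N0]
      proof eventually_elim
        case (elim N)
        have N: "real N > 0" using N0(1)[OF elim] by simp
        have "\<bar>T N - s * real N\<bar> \<le> real N * e N + s" using T[OF elim] s by (simp add: algebra_simps abs_le_iff)
        then have "\<bar>T N - s * real N\<bar> / real N \<le> (real N * e N + s) / real N"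
          using N by (intro divide_right_mono) auto
        moreover have "\<bar>T N - s * real N\<bar> / real N = \<bar>T N / real N - s\<bar>"
        proof -
          have "T N / real N - s = (T N - s * real N) / real N" using N by (simp add: field_simps)
          then show ?thesis using N by simp
        qed
        ultimately show ?case using N by (simp add: add_divide_distrib)
      qed
    qed
    then have T_lim: "(\<lambda>N. T N / real N) \<longlonglongrightarrow> s" by (simp add: LIM_zero_iff)
    have k1_top: "filterlim (\<lambda>k. (k1 k)\<^sup>2) at_top sequentially"
    proof (rule filterlim_at_top_mono[OF filterlim_ident])
      have "k * 1 \<le> k1 k * k1 k" for k
        using k1(2)[of k] by (intro mult_mono) (auto simp: k1_def)
      then have "k \<le> (k1 k)\<^sup>2" for k by (simp add: power2_eq_square)
      then show "\<forall>\<^sub>F k in sequentially. k \<le> (k1 k)\<^sup>2" by simp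
    qed
    have "(\<lambda>k. 2 * (D ((k1 k)\<^sup>2) u / real ((k1 k)\<^sup>2) + T ((k1 k)\<^sup>2) / real ((k1 k)\<^sup>2))) \<longlonglongrightarrow> 2 * (0 + s)"
      by (intro tendsto_mult tendsto_add tendsto_const D0 filterlim_compose[OF T_lim k1_top])
    then have "(\<lambda>k. real (pair_count (\<lambda>n. \<alpha> * perturbed \<delta> u n) ((k1 k)\<^sup>2) s) / real ((k1 k)\<^sup>2)) \<longlonglongrightarrow> 2 * s"
      unfolding count by (simp add: add_divide_distrib)
    then show "(\<lambda>k. real (pair_count (\<lambda>n. \<alpha> * perturbed \<delta> u n) (k\<^sup>2) s) / real (k\<^sup>2)) \<longlonglongrightarrow> 2 * s"
      unfolding k1_def by (rule LIMSEQ_offset)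
  qed
qed

section \<open>Existence of the perturbation\<close>

lemma good_multiplier_minus:
  assumes "good_multiplier \<delta> \<alpha>"
  shows "good_multiplier \<delta> (- \<alpha>)"
proof -
  obtain q h where qh: "\<And>j. q j > 0" "\<And>j. coprime (h j) (int (q j))"
    "\<And>j. \<bar>real (q j) * (- 2 * \<alpha>) - of_int (h j)\<bar> \<le> 1 / real (q j)"
    and lim: "(\<lambda>j. 1 / (real (q j) * \<delta> j)) \<longlonglongrightarrow> 0" "(\<lambda>j. real (q j) / 2 ^ j) \<longlonglongrightarrow> 0"
    using assms unfolding good_multiplier_def by blast
  have "\<bar>real (q j) * (- 2 * - \<alpha>) - of_int (- h j)\<bar> \<le> 1 / real (q j)" for j
    using qh(3)[of j] by (simp add: abs_le_iff)
  then show ?thesis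
    unfolding good_multiplier_def using qh(1,2) lim
    by (intro exI[of _ q] exI[of _ "\<lambda>j. - h j"]) simp
qed

lemma pair_count_minus: "pair_count (\<lambda>n. - y n) N s = pair_count y N s"
proof -
  have "dist_int (- y m - - y n) < r \<longleftrightarrow> dist_int (y m - y n) < r" for m n r
    using dist_int_minus_less_iff[of "y m - y n" r] by simp
  then show ?thesis by (simp only: pair_count_def)
qed

text \<open>Countably many tolerances \<open>1 / Suc i\<close> suffice to express convergence, so
  measurability follows from countable operations.\<close>

lemma pred_LIMSEQ:
  fixes F :: "nat \<Rightarrow> 'a \<Rightarrow> real"
  assumes [measurable]: "\<And>k. F k \<in> borel_measurable M"
  shows "Measurable.pred M (\<lambda>x. (\<lambda>k. F k x) \<longlonglongrightarrow> c)"
proof -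
  have "(\<lambda>k. F k x) \<longlonglongrightarrow> c \<longleftrightarrow> (\<forall>i::nat. \<exists>K. \<forall>k. K \<le> k \<longrightarrow> \<bar>F k x - c\<bar> < 1 / real (Suc i))" for x
  proof
    assume "(\<lambda>k. F k x) \<longlonglongrightarrow> c"
    then show "\<forall>i::nat. \<exists>K. \<forall>k. K \<le> k \<longrightarrow> \<bar>F k x - c\<bar> < 1 / real (Suc i)"
      unfolding LIMSEQ_iff by (metis of_nat_0_less_iff real_norm_def zero_less_Suc zero_less_divide_1_iff)
  next
    assume *: "\<forall>i::nat. \<exists>K. \<forall>k. K \<le> k \<longrightarrow> \<bar>F k x - c\<bar> < 1 / real (Suc i)"
    show "(\<lambda>k. F k x) \<longlonglongrightarrow> c"
    proof (rule LIMSEQ_I)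
      fix r :: real assume "r > 0"
      then obtain i where i: "1 / real (Suc i) < r" using nat_approx_posE by blast
      obtain K where "\<And>k. K \<le> k \<Longrightarrow> \<bar>F k x - c\<bar> < 1 / real (Suc i)" using * by blast
      with i show "\<exists>no. \<forall>k\<ge>no. norm (F k x - c) < r"
        by (intro exI[of _ K]) (auto intro: less_trans)
    qed
  qed
  then show ?thesis by simp
qed

text \<open>For each good nonzero \<alpha> almost every sample works. Fubini turns this into almost
  every sample working for almost every \<alpha>, and any such sample is a witness.\<close>

lemma exists_perturbation:
  fixes \<delta> b :: "nat \<Rightarrow> real"
  assumes \<delta>: "\<And>j. \<delta> j > 0" and b: "\<And>j. b j > 0" and b_lim: "filterlim b at_top sequentially"
    and sm: "summable (\<lambda>j. b j / (2 ^ j * \<delta> j))"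
  shows "\<exists>u. AE \<alpha> in lborel. poissonian_pc (\<lambda>n. \<alpha> * perturbed \<delta> u n)"
proof -
  have L: "(\<lambda>j. 1 / (2 ^ j * \<delta> j)) \<longlonglongrightarrow> 0"
  proof (rule tendsto_sandwich[OF _ _ tendsto_const summable_LIMSEQ_zero[OF sm]])
    have "\<forall>\<^sub>F j in sequentially. b j \<ge> 1" using b_lim by (simp add: filterlim_at_top)
    then show "\<forall>\<^sub>F j in sequentially. 1 / (2 ^ j * \<delta> j) \<le> b j / (2 ^ j * \<delta> j)"
    proof eventually_elim
      case (elim j)
      then show ?case using \<delta>[of j] by (intro divide_right_mono) auto
    qed
  qed (use \<delta> in \<open>simp add: less_imp_le\<close>)
  \<comment> \<open>Only squares and rational windows occur, so \<open>P\<close> is a countable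
    conjunction; this gives both the almost sure statement and the joint measurability that Fubini
    needs.\<close>
  define P where "P u \<alpha> \<longleftrightarrow> (\<forall>r\<in>{0::rat<..}.
    (\<lambda>k. real (pair_count (\<lambda>n. \<alpha> * perturbed \<delta> u n) (k\<^sup>2) (of_rat r)) / real (k\<^sup>2)) \<longlonglongrightarrow> 2 * of_rat r)"
    for u :: "nat \<Rightarrow> real" and \<alpha> :: real
  have pos: "AE u in unif.iid. P u \<alpha>" if "\<alpha> > 0" "good_multiplier \<delta> \<alpha>" for \<alpha>
    unfolding P_def using AE_pair_count_squares[OF \<delta> L that]
    by (subst AE_ball_countable) auto
  interpret Q: pair_sigma_finite unif.iid "lborel :: real measure" ..
  have "AE \<alpha> in lborel. AE u in unif.iid. P u \<alpha>"
    using AE_good_multiplier[OF assms] AE_lborel_singleton[of "0::real"]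
  proof eventually_elim
    case (elim \<alpha>)
    show ?case
    proof (cases "\<alpha> > 0")
      \<comment> \<open>The value 0 was discarded as a null set, and negative \<alpha> reduce to
        positive ones because pair counts ignore the sign.\<close>
      case False
      with elim have "AE u in unif.iid. P u (- \<alpha>)"
        by (intro pos good_multiplier_minus) auto
      moreover have "P u (- \<alpha>) \<longleftrightarrow> P u \<alpha>" for u
        unfolding P_def by (simp add: pair_count_minus)
      ultimately show ?thesis by simp
    qed (use pos elim in blast)
  qed
  moreover have "{z \<in> space (unif.iid \<Otimes>\<^sub>M lborel). P (fst z) (snd z)} \<in> sets (unif.iid \<Otimes>\<^sub>M lborel)"
  proof -
    have comp [measurable]: "(\<lambda>z. perturbed \<delta> (fst z) n) \<in> borel_measurable (unif.iid \<Otimes>\<^sub>M lborel)" for n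
    proof -
      have "(\<lambda>u. u n) \<in> measurable unif.iid unif" by (rule measurable_component_singleton) simp
      then have "(\<lambda>u. u n) \<in> borel_measurable unif.iid" by (simp cong: measurable_cong_sets)
      then have [measurable]: "(\<lambda>z. fst z n) \<in> borel_measurable (unif.iid \<Otimes>\<^sub>M lborel)"
        using measurable_compose[OF measurable_fst] by blast
      show ?thesis unfolding perturbed_def by measurable
    qed
    have "(\<lambda>z. real (pair_count (\<lambda>n. snd z * perturbed \<delta> (fst z) n) (k\<^sup>2) s) / real (k\<^sup>2))
        \<in> borel_measurable (unif.iid \<Otimes>\<^sub>M lborel)" for k s
      unfolding pair_count_eq_sum by measurable
    then have "Measurable.pred (unif.iid \<Otimes>\<^sub>M lborel) (\<lambda>z. P (fst z) (snd z))"
      unfolding P_def by (intro pred_intros_countable_bounded(3) pred_LIMSEQ)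
    then show ?thesis by (simp add: pred_def)
  qed
  ultimately have "AE u in unif.iid. AE \<alpha> in lborel. P u \<alpha>"
    using Q.AE_commute[of P] by blast
  then obtain u where u: "AE \<alpha> in lborel. P u \<alpha>"
    using eventually_happens'[OF unif.iid.ae_filter_bot] by blast
  have "AE \<alpha> in lborel. poissonian_pc (\<lambda>n. \<alpha> * perturbed \<delta> u n)"
    using u
  proof eventually_elim
    case (elim \<alpha>)
    show ?case
    proof (rule poissonian_pc_from_squares)
      fix s :: real assume "s \<in> \<rat>" "s > 0"
      then obtain r where "s = of_rat r" "r > 0" by (auto elim: Rats_cases)
      with elim show "(\<lambda>k. real (pair_count (\<lambda>n. \<alpha> * perturbed \<delta> u n) (k\<^sup>2) s) / real (k\<^sup>2)) \<longlonglongrightarrow> 2 * s"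
        by (simp add: P_def)
    qed
  qed
  then show ?thesis by blast
qed

text \<open>Up to the factor \<open>- e\<close>, the summand is the derivative of
  \<open>ln (t * ln 2) powr (- e)\<close> at \<open>t = j\<close>, so the series is comparable to a
  telescoping one.\<close>

lemma summable_inverse_mult_ln_powr:
  fixes e :: real
  assumes "e > 0"
  shows "summable (\<lambda>j. 1 / (real j * ln (real j * ln 2) powr (1 + e)))"
proof (rule summable_comparison_test_bigo)
  define t :: "nat \<Rightarrow> real" where "t j = ln (real j * ln 2) powr (- e)" for j
  have "t \<longlonglongrightarrow> 0" unfolding t_def using assms by real_asymp
  then have "summable (\<lambda>j. t j - t (Suc j))" by (rule telescope_summable')
  moreover have "\<forall>\<^sub>F j in sequentially. t j - t (Suc j) \<ge> 0"
    unfolding t_def using assms by real_asymp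
  then have "\<forall>\<^sub>F j in sequentially. t j - t (Suc j) = norm (t j - t (Suc j))"
    by eventually_elim simp
  ultimately show "summable (\<lambda>j. norm (t j - t (Suc j)))"
    using summable_cong by fast
  show "(\<lambda>j. 1 / (real j * ln (real j * ln 2) powr (1 + e))) \<in> O(\<lambda>j. t j - t (Suc j))"
    unfolding t_def using assms by real_asymp
qed

theorem theorem1:
  fixes c :: real
  assumes "c > 0"
  shows "\<exists>x :: nat \<Rightarrow> real.
     (\<forall>n\<ge>1. x n < x (Suc n) \<and> x (Suc n) - x n \<ge> 1) \<and>
     (\<exists>C>0. \<forall>\<^sub>F N in sequentially.
        real (add_energy x N (ln (real N) * (ln (ln (real N))) powr (1 + c) / real N))
          \<ge> C * real N ^ 3) \<and>
     (AE \<alpha> in lborel. poissonian_pc (\<lambda>n. \<alpha> * x n))"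
proof -
  define g where "g t = ln t * ln (ln t) powr (1 + c)" for t :: real
  \<comment> \<open>With \<open>g N / N\<close> being the scale of the theorem, this is that scale
    at \<open>2 ^ j\<close> divided by 16; then \<open>2 * d j\<close> stays below the scale at
    \<open>N\<close> for large \<open>N\<close> between \<open>2 * 2 ^ j\<close> and
    \<open>4 * 2 ^ j\<close>.\<close>
  define d where "d j = g (2 ^ j) / (16 * 2 ^ j)" for j :: nat
  \<comment> \<open>The default 1, taken for only finitely many \<open>j\<close>, keeps every
    amplitude in \<open>(0, 1]\<close>.\<close>
  define \<delta> where "\<delta> j = (if 0 < d j \<and> d j \<le> 1 then d j else 1)" for j
  have g_pow: "g (2 ^ j) = (real j * ln 2) * ln (real j * ln 2) powr (1 + c)" for j
    by (simp add: g_def ln_realpow)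
  have "\<forall>\<^sub>F j in sequentially. 0 < d j \<and> d j \<le> 1"
    unfolding d_def g_pow by (intro eventually_conj; real_asymp)
  then have ev\<delta>: "\<forall>\<^sub>F j in sequentially. \<delta> j = d j"
    by eventually_elim (simp add: \<delta>_def)
  have \<delta>: "\<delta> j > 0" "\<delta> j \<le> 1" for j by (auto simp: \<delta>_def)
  \<comment> \<open>\<open>b\<close> spends half of the exponent \<open>c\<close>: it diverges,
    while \<open>b j / (2 ^ j * \<delta> j)\<close> keeps the exponent \<open>1 + c / 2\<close> on
    the iterated logarithm and stays summable. The cutoff at 1 matters only for small
    \<open>j\<close>.\<close>
  define b where "b j = (if 1 \<le> j then max 1 (ln (real j * ln 2) powr (c / 2)) else 1)" for j :: nat
  have b_ev: "\<forall>\<^sub>F j in sequentially. b j = ln (real j * ln 2) powr (c / 2)"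
  proof -
    have "\<forall>\<^sub>F j in sequentially. 1 \<le> ln (real j * ln 2) powr (c / 2)"
      using assms by real_asymp
    then show ?thesis using eventually_ge_at_top[of 1] by eventually_elim (simp add: b_def)
  qed
  have b: "b j > 0" for j by (simp add: b_def less_max_iff_disj)
  have b_lim: "filterlim b at_top sequentially"
  proof -
    have "filterlim (\<lambda>j. ln (real j * ln 2) powr (c / 2)) at_top sequentially"
      using assms by real_asymp
    then show ?thesis using filterlim_cong[OF refl refl b_ev] by simp
  qed
  have "summable (\<lambda>j. b j / (2 ^ j * \<delta> j))"
  proof -
    have "\<forall>\<^sub>F j in sequentially. b j / (2 ^ j * \<delta> j)
        = 16 / ln 2 * (1 / (real j * ln (real j * ln 2) powr (1 + c / 2)))"
    proof -
      have "\<forall>\<^sub>F j in sequentially. ln (real j * ln 2) > 0" by real_asymp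
      with ev\<delta> b_ev show ?thesis
      proof eventually_elim
        case (elim j)
        have "ln (real j * ln 2) powr (1 + c) = ln (real j * ln 2) powr (c / 2) * ln (real j * ln 2) powr (1 + c / 2)"
          by (simp add: powr_add[symmetric] add.commute)
        then show ?case
          unfolding elim(1,2) using elim(3) by (simp add: d_def g_pow)
      qed
    qed
    then show ?thesis
      using summable_mult[OF summable_inverse_mult_ln_powr[of "c / 2"], of "16 / ln 2"] assms
      by (simp add: summable_cong)
  qed
  then obtain u where u: "AE \<alpha> in lborel. poissonian_pc (\<lambda>n. \<alpha> * perturbed \<delta> u n)"
    using exists_perturbation[of \<delta> b] \<delta> b b_lim by blast
  define x where "x = perturbed \<delta> u"
  have clip: "0 \<le> clip y" "clip y \<le> 1" for y by (auto simp: clip_def)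
  have x_bounds: "2 * real n \<le> x n" "x n \<le> 2 * real n + 1" for n
  proof -
    have "\<delta> (floor_log n) * clip (u n) \<le> 1 * 1"
      using \<delta>[of "floor_log n"] clip[of "u n"] by (intro mult_mono) auto
    then show "x n \<le> 2 * real n + 1" by (simp add: x_def perturbed_def)
    show "2 * real n \<le> x n" using \<delta>(1)[of "floor_log n"] clip[of "u n"] by (simp add: x_def perturbed_def)
  qed
  have gap: "x (Suc n) - x n \<ge> 1" for n
    using x_bounds(1)[of "Suc n"] x_bounds(2)[of n] by simp
  have energy: "\<forall>\<^sub>F N in sequentially.
        real (add_energy x N (ln (real N) * (ln (ln (real N))) powr (1 + c) / real N)) \<ge> 1 / 512 * real N ^ 3"
  proof -
    have lim: "filterlim (\<lambda>N. floor_log N - 1) at_top sequentially"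
      by (rule filterlim_compose[OF _ filterlim_floor_log]) (rule filterlim_minus_const_nat_at_top)
    show ?thesis
      using eventually_ge_at_top[of 16] eventually_compose_filterlim[OF ev\<delta> lim]
        eventually_compose_filterlim[OF \<open>\<forall>\<^sub>F j in sequentially. 0 < d j \<and> d j \<le> 1\<close> lim]
    proof eventually_elim
      case (elim N)
      define j where "j = floor_log N - 1"
      have fl: "floor_log N \<ge> 4" using floor_log_le_iff[OF elim(1)] floor_log_power[of 4] by simp
      have "(2::nat) * 2 ^ j \<le> N" "N < 4 * 2 ^ j"
      proof -
        have "floor_log N = Suc j" using fl by (simp add: j_def)
        then show "(2::nat) * 2 ^ j \<le> N" "N < 4 * 2 ^ j"
          using floor_log_exp2_le[of N] floor_log_exp2_gt[of N] elim(1) by auto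
      qed
      then have Nj: "2 * 2 ^ j \<le> real N" "real N < 4 * 2 ^ j"
        by (simp_all flip: of_nat_less_iff[where 'a = real] of_nat_le_iff[where 'a = real])
      \<comment> \<open>As \<open>2 ^ j \<ge> 8\<close> exceeds \<open>exp 1\<close>, the logarithm
        of \<open>2 ^ j\<close> is at least 1 and the iterated one is nonnegative, where
        \<open>powr\<close> with a positive exponent is monotone.\<close>
      have "(2::real) ^ 3 \<le> 2 ^ j" using fl by (intro power_increasing) (auto simp: j_def)
      then have t: "(8::real) \<le> 2 ^ j" by simp
      have "exp 1 \<le> (3::real)" by (rule exp_le)
      then have ln1: "1 \<le> ln (2 ^ j :: real)" using t by (subst ln_ge_iff) auto
      have ln2: "ln (2 ^ j) \<le> ln (real N)" using Nj t by (intro ln_mono) linarith+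
      have "ln (ln (2 ^ j :: real)) \<le> ln (ln (real N))" by (rule ln_mono) (use ln1 ln2 in linarith)+
      then have "g (2 ^ j) \<le> g (real N)"
        unfolding g_def using ln1 ln2 assms
        by (intro mult_mono powr_mono2) auto
      moreover have "g (2 ^ j) > 0" using elim(3)[folded j_def] by (simp add: d_def zero_less_divide_iff)
      ultimately have "g (2 ^ j) / (4 * 2 ^ j) < g (real N) / real N"
        using Nj t by (intro frac_less2) auto
      moreover have "2 * \<delta> j = g (2 ^ j) / (8 * 2 ^ j)" using elim(2)[folded j_def] by (simp add: d_def)
      moreover have "g (2 ^ j) / (8 * 2 ^ j) \<le> g (2 ^ j) / (4 * 2 ^ j)"
        using \<open>g (2 ^ j) > 0\<close> by (intro divide_left_mono) auto
      ultimately have "2 * \<delta> (floor_log N - 1) < g (real N) / real N" by (simp add: j_def)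
      then show ?case
        using add_energy_ge[of \<delta> "\<lambda>n. clip (u n)" N "g (real N) / real N"] \<delta>(1) clip elim(1)
        by (simp add: x_def perturbed_def[abs_def] g_def less_imp_le)
    qed
  qed
  show ?thesis
  proof (intro exI[of _ x] conjI allI impI)
    show "x n < x (Suc n)" "x (Suc n) - x n \<ge> 1" for n using gap[of n] by auto
    show "\<exists>C>0. \<forall>\<^sub>F N in sequentially.
        real (add_energy x N (ln (real N) * (ln (ln (real N))) powr (1 + c) / real N)) \<ge> C * real N ^ 3"
      using energy by (intro exI[of _ "1 / 512"]) simp
    show "AE \<alpha> in lborel. poissonian_pc (\<lambda>n. \<alpha> * x n)" using u by (simp add: x_def)
  qed
qed

end
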